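(* Let $t(\tau)=(\eta(2\tau)/\eta(\tau))^{24}$, $J(\tau)=2E_2(2\tau)-E_2(\tau)$ and $$C_{6a}=\frac{t(5+1408t+20480t^2)}{9(1-64t)^3}\bigl(8J^3+E_6\bigr)=\sum_{n\ge1}c_{6a}(n)q^n,$$ $$C_{6b}=\frac{t(1-64t)}{9(1+64t)^2}\bigl(8J^3+E_6\bigr)=\sum_{n\ge1}c_{6b}(n)q^n.$$ Then for all integers $m,r\ge1$, $$v_2\bigl(c_{6a}(2^rm)\bigr)\ge5r,\qquad v_2\bigl(c_{6b}(2^rm)\bigr)\ge5r.$$
   Context: $q=e^{2\pi i\tau}$; $\eta(\tau)=q^{1/24}\prod_{n\ge1}(1-q^n)$; $E_2=1-24\sum_{n\ge1}\sigma_1(n)q^n$; $E_6=1-504\sum_{n\ge1}\sigma_5(n)q^n$. The rational expressions in $t=q+24q^2+\cdots$ are expanded as power series in $q$. $v_2$ is the $2$-adic valuation. *)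

theory Defs
  imports "HOL-Analysis.Analysis" "HOL-Computational_Algebra.Computational_Algebra"
begin

definition nome :: "complex \<Rightarrow> complex" where
  "nome \<tau> = exp (2 * of_real pi * \<i> * \<tau>)"

definition eta :: "complex \<Rightarrow> complex" where
  "eta \<tau> = exp (2 * of_real pi * \<i> * \<tau> / 24) * (\<Prod>n. 1 - nome \<tau> ^ Suc n)"

definition divisor_sum :: "nat \<Rightarrow> nat \<Rightarrow> nat" where
  "divisor_sum k n = (\<Sum>d | d dvd n. d ^ k)"

definition E2 :: "complex \<Rightarrow> complex" where
  "E2 \<tau> = 1 - 24 * (\<Sum>n. of_nat (divisor_sum 1 (Suc n)) * nome \<tau> ^ Suc n)"

definition E6 :: "complex \<Rightarrow> complex" where
  "E6 \<tau> = 1 - 504 * (\<Sum>n. of_nat (divisor_sum 5 (Suc n)) * nome \<tau> ^ Suc n)"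

definition t :: "complex \<Rightarrow> complex" where
  "t \<tau> = (eta (2 * \<tau>) / eta \<tau>) ^ 24"

definition J :: "complex \<Rightarrow> complex" where
  "J \<tau> = 2 * E2 (2 * \<tau>) - E2 \<tau>"

definition C6a :: "complex \<Rightarrow> complex" where
  "C6a \<tau> = t \<tau> * (5 + 1408 * t \<tau> + 20480 * t \<tau> ^ 2) / (9 * (1 - 64 * t \<tau>) ^ 3)
             * (8 * J \<tau> ^ 3 + E6 \<tau>)"

definition C6b :: "complex \<Rightarrow> complex" where
  "C6b \<tau> = t \<tau> * (1 - 64 * t \<tau>) / (9 * (1 + 64 * t \<tau>) ^ 2)
             * (8 * J \<tau> ^ 3 + E6 \<tau>)"

text \<open>The expansion \<open>F = (\<Sum>n\<ge>1. c n * q ^ n)\<close> at the cusp \<open>i\<infinity>\<close>. It is only required for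
  \<open>q = nome \<tau>\<close> close to 0, because \<open>C6a\<close> and \<open>C6b\<close> have poles in the upper half-plane. This
  determines \<open>c n\<close> for all \<open>n \<ge> 1\<close>; the value \<open>c 0\<close> is irrelevant.\<close>

definition has_q_expansion :: "(complex \<Rightarrow> complex) \<Rightarrow> (nat \<Rightarrow> rat) \<Rightarrow> bool" where
  "has_q_expansion F c \<longleftrightarrow>
     (\<exists>R. \<forall>\<tau>. Im \<tau> > R \<longrightarrow> (\<lambda>n. of_rat (c (Suc n)) * nome \<tau> ^ Suc n) sums F \<tau>)"

text \<open>The 2-adic valuation on the rationals, with \<open>v2 0 = \<infinity>\<close>.\<close>

definition v2 :: "rat \<Rightarrow> ereal" where
  "v2 x = (if x = 0 then \<infinity>
           else case quotient_of x of (a, b) \<Rightarrow>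
             ereal (real (multiplicity 2 a) - real (multiplicity 2 b)))"

end

theory Submission
  imports Defs "HOL-Complex_Analysis.Complex_Analysis"
begin

text \<open>
  Let \<open>A = \<theta>\<^sub>4\<^sup>8\<close>, where \<open>\<theta>\<^sub>4 = \<Sum>(-1)\<^sup>n q^(n\<^sup>2)\<close>, and let \<open>D = q d/dq\<close>. Since \<open>8 J\<^sup>3 + E\<^sub>6 = 9 J A\<close> and \<open>J = Dt/t\<close>, both
  series have the shape \<open>A \<cdot> Dt \<cdot> R(64t)\<close> with \<open>R\<close> a power series with integer coefficients. The operator
  \<open>U : \<Sum> a(n) q\<^sup>n \<mapsto> \<Sum> a(2n) q\<^sup>n\<close> maps the module of all such series into \<open>32\<close> times itself:
  with \<open>T = t(q\<^sup>2)\<close> there is a series \<open>w\<close> such that \<open>t = w + 16w\<^sup>2\<close>, \<open>w\<^sup>2 = T (1 + 16w)\<close> and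
  \<open>A(q\<^sup>2) = A (1 + 16w)\<close>, so in terms of \<open>W = 16w\<close> everything reduces to the action of \<open>U\<close> on
  \<open>Dw\<close> and \<open>W Dw\<close> over the ring of polynomials in \<open>256T\<close>.

  The modular identities come from Liouville's elementary identity for the sum over
  \<open>m\<^sup>2 + d\<delta> = N\<close> with \<open>\<delta>\<close> odd, which expresses \<open>D \<theta>\<^sub>4\<close>, \<open>D\<^sup>2 \<theta>\<^sub>4\<close> and \<open>D\<^sup>3 \<theta>\<^sub>4\<close> through Lambert series, and from
  the doubling formulas \<open>\<theta>\<^sub>3 \<theta>\<^sub>4 = \<theta>\<^sub>4(q\<^sup>2)\<^sup>2\<close> and \<open>\<theta>\<^sub>3\<^sup>2 + \<theta>\<^sub>4\<^sup>2 = 2 \<theta>\<^sub>3(q\<^sup>2)\<^sup>2\<close>; each further identity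
  holds because the difference of its sides satisfies \<open>h = c h(q\<^sup>2)\<close> and vanishes at \<open>q = 0\<close>.
\<close>

unbundle no vec_syntax

section \<open>Power series in the nome\<close>

definition dil :: "'a::idom fps \<Rightarrow> 'a fps" where
  "dil f = f oo fps_X ^ 2"

definition qderiv :: "'a::idom fps \<Rightarrow> 'a fps" where
  "qderiv f = fps_X * fps_deriv f"

lemma dil_nth: "dil f $ n = (if even n then f $ (n div 2) else 0)"
proof -
  have "dil f $ n = (\<Sum>i = 0..n. f $ i * (if n = 2 * i then 1 else 0))"
    unfolding dil_def fps_compose_nth power_mult [symmetric] fps_X_power_nth by simp
  also have "\<dots> = (\<Sum>i \<in> (if even n then {n div 2} else {}). f $ i)"
    by (rule sum.mono_neutral_cong_right) (auto split: if_splits)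
  finally show ?thesis by simp
qed

lemma dil_0 [simp]: "dil 0 = 0"
  and dil_1 [simp]: "dil 1 = 1"
  and dil_add [simp]: "dil (f + g) = dil f + dil g"
  and dil_diff [simp]: "dil (f - g) = dil f - dil g"
  and dil_minus [simp]: "dil (- f) = - dil f"
  and dil_mult [simp]: "dil (f * g) = dil f * dil g"
  and dil_power [simp]: "dil (f ^ n) = dil f ^ n"
  and dil_numeral [simp]: "dil (numeral k) = numeral k"
  and dil_const [simp]: "dil (fps_const c) = fps_const c"
  by (simp_all add: dil_def fps_compose_add_distrib fps_compose_sub_distrib fps_compose_uminus
        fps_compose_mult_distrib fps_compose_power)

lemma qderiv_nth: "qderiv f $ n = of_nat n * f $ n"
  by (cases n) (simp_all add: qderiv_def)

lemma qderiv_add [simp]: "qderiv (f + g) = qderiv f + qderiv g"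
  and qderiv_diff [simp]: "qderiv (f - g) = qderiv f - qderiv g"
  and qderiv_minus [simp]: "qderiv (- f) = - qderiv f"
  and qderiv_mult [simp]: "qderiv (f * g) = qderiv f * g + f * qderiv g"
  and qderiv_numeral [simp]: "qderiv (numeral k) = 0"
  and qderiv_1 [simp]: "qderiv 1 = 0"
  by (simp_all add: qderiv_def algebra_simps)

lemma qderiv_dil: "qderiv (dil f) = 2 * dil (qderiv f)"
  by (rule fps_ext) (auto simp: qderiv_nth dil_nth numeral_fps_const elim!: evenE)

text \<open>For \<open>k > 0\<close> the coefficient of \<open>dil h\<close> at \<open>k\<close> is
  zero or that of \<open>h\<close> at \<open>k div 2 < k\<close>, so a series
  \<open>h = c * dil h\<close> without constant term vanishes by strong induction. This takes the
  place of a dimension bound for modular forms.\<close>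

lemma dil_eqI:
  fixes f :: "'a::idom fps"
  assumes "f - g = c * dil (f - g)" "f $ 0 = g $ 0"
  shows "f = g"
proof -
  define h where "h = f - g"
  have h: "h = c * dil h" "h $ 0 = 0" using assms by (simp_all add: h_def del: dil_diff)
  have "h $ n = 0" for n
  proof (induction n rule: less_induct)
    case (less n)
    have "dil h $ k = 0" if "k \<le> n" for k
      using that less.IH [of "k div 2"] h(2) by (cases "k = 0") (auto simp: dil_nth)
    hence "(\<Sum>i = 0..n. c $ i * dil h $ (n - i)) = 0"
      by (intro sum.neutral) simp
    thus ?case using h(1) by (metis fps_mult_nth)
  qed
  hence "h = 0" by (simp add: fps_eq_iff)
  thus ?thesis by (simp add: h_def)
qed

text \<open>Comparing lowest coefficients of the difference shows that its order would be
  \<open>k $ 0 = m\<close>, but at index \<open>m\<close> both solutions agree.\<close>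

lemma qderiv_ode_unique:
  fixes f g :: "'a::{idom,ring_char_0} fps"
  assumes f: "qderiv f = f * k" and g: "qderiv g = g * k" and k: "k $ 0 = of_nat m"
    and m: "f $ m = g $ m"
  shows "f = g"
proof (rule ccontr)
  assume "f \<noteq> g"
  define h where "h = f - g"
  define s where "s = subdegree h"
  have h: "h \<noteq> 0" "qderiv h = h * k"
    using \<open>f \<noteq> g\<close> f g by (auto simp: h_def algebra_simps)
  have "qderiv h $ s = h $ s * k $ 0"
    unfolding h(2) fps_mult_nth
    by (subst sum.remove [of _ s])
      (auto intro!: sum.neutral simp: s_def intro: ccontr,
        metis nth_less_subdegree_zero le_neq_implies_less)
  moreover have "h $ s \<noteq> 0" using h(1) by (simp add: s_def)
  ultimately have "(of_nat s :: 'a) = of_nat m"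
    using k by (simp add: qderiv_nth)
  hence "s = m" by simp
  with m \<open>h $ s \<noteq> 0\<close> show False by (simp add: h_def)
qed

text \<open>The formal sum of \<open>c i * q ^ e i\<close> over \<open>I\<close>. An infinite fibre
  of \<open>e\<close> would count as \<open>0\<close>, which is why the product rule below asks for
  finite fibres.\<close>

definition wsum :: "'i set \<Rightarrow> ('i \<Rightarrow> nat) \<Rightarrow> ('i \<Rightarrow> int) \<Rightarrow> int fps" where
  "wsum I e c = Abs_fps (\<lambda>N. \<Sum>i | i \<in> I \<and> e i = N. c i)"

lemma wsum_mult:
  assumes "\<And>N. finite {i \<in> I. e i = N}" "\<And>N. finite {j \<in> K. e' j = N}"
  shows "wsum I e c * wsum K e' c' = wsum (I \<times> K) (\<lambda>(i, j). e i + e' j) (\<lambda>(i, j). c i * c' j)"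
proof (rule fps_ext)
  fix N
  have "(wsum I e c * wsum K e' c') $ N =
      (\<Sum>k\<in>{0..N}. \<Sum>p \<in> {i \<in> I. e i = k} \<times> {j \<in> K. e' j = N - k}. case p of (i, j) \<Rightarrow> c i * c' j)"
    by (simp add: wsum_def fps_mult_nth sum_product sum.cartesian_product)
  also have "\<dots> = (\<Sum>(k, p) \<in> (SIGMA k:{0..N}. {i \<in> I. e i = k} \<times> {j \<in> K. e' j = N - k}).
      case p of (i, j) \<Rightarrow> c i * c' j)"
    by (rule sum.Sigma) (use assms in auto)
  also have "\<dots> = (\<Sum>(i, j) | (i, j) \<in> I \<times> K \<and> e i + e' j = N. c i * c' j)"
    by (rule sum.reindex_bij_witness [where i = "\<lambda>(i, j). (e i, (i, j))" and j = snd]) auto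
  also have "\<dots> = wsum (I \<times> K) (\<lambda>(i, j). e i + e' j) (\<lambda>(i, j). c i * c' j) $ N"
    by (auto simp: wsum_def intro!: sum.cong)
  finally show "(wsum I e c * wsum K e' c') $ N =
    wsum (I \<times> K) (\<lambda>(i, j). e i + e' j) (\<lambda>(i, j). c i * c' j) $ N" .
qed

section \<open>A Liouville identity\<close>

definition parity_sgn :: "int \<Rightarrow> int" where
  "parity_sgn n = (if even n then 1 else -1)"

lemma parity_sgn_minus [simp]: "parity_sgn (- n) = parity_sgn n"
  and parity_sgn_add: "parity_sgn (m + n) = parity_sgn m * parity_sgn n"
  and parity_sgn_diff: "parity_sgn (m - n) = parity_sgn m * parity_sgn n"
  by (auto simp: parity_sgn_def)

text \<open>Encodes the solutions of \<open>m\<^sup>2 + d * \<delta> = N\<close> for which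
  \<open>m + d\<close> or \<open>m - d\<close> equals \<open>n\<close>: the sign of \<open>e\<close>
  tells which, with \<open>d = \<bar>e\<bar>\<close> and \<open>m = n - e\<close>.\<close>

definition fiber :: "int \<Rightarrow> int \<Rightarrow> (int \<times> int) set" where
  "fiber N n = {(e, \<delta>). e \<noteq> 0 \<and> 0 < \<delta> \<and> odd \<delta> \<and> (n - e)\<^sup>2 + \<bar>e\<bar> * \<delta> = N}"

lemma sum_antisym_bij_eq_0:
  fixes w :: "'b \<Rightarrow> int"
  assumes "\<And>x. x \<in> A \<Longrightarrow> i x \<in> A" "\<And>x. x \<in> A \<Longrightarrow> i (i x) = x" "\<And>x. x \<in> A \<Longrightarrow> w (i x) = - w x"
  shows "sum w A = 0"
proof -
  have "sum w A = (\<Sum>x\<in>A. - w x)"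
    by (rule sum.reindex_bij_witness [of _ i i]) (use assms in auto)
  thus ?thesis by (simp add: sum_negf)
qed

text \<open>
  The condition in \<open>fiber N n\<close> says \<open>e k = n\<^sup>2 - N\<close> for \<open>k = 2 n - e - sgn e \<delta>\<close>, and \<open>e\<close>, \<open>k\<close> have different
  parities because \<open>\<delta>\<close> is odd. If \<open>n\<^sup>2 > N\<close>, exchanging \<open>e\<close> and \<open>k\<close> cancels the summands in pairs.
\<close>

lemma fiber_sum_pos:
  assumes "n\<^sup>2 > N"
  shows "(\<Sum>(e, \<delta>) \<in> fiber N n. sgn e * parity_sgn e) = 0"
proof (rule sum_antisym_bij_eq_0 [where i = "\<lambda>(e, \<delta>). (2 * n - e - sgn e * \<delta>, \<delta>)"])
  have key: "sgn (2 * n - e - sgn e * \<delta>) = sgn e \<and>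
      (2 * n - e - sgn e * \<delta>, \<delta>) \<in> fiber N n" if "(e, \<delta>) \<in> fiber N n" for e \<delta>
  proof -
    define k where "k = 2 * n - e - sgn e * \<delta>"
    have e: "e \<noteq> 0" "0 < \<delta>" "odd \<delta>" "(n - e)\<^sup>2 + \<bar>e\<bar> * \<delta> = N" using that by (auto simp: fiber_def)
    have ek: "e * k = n\<^sup>2 - N"
      using e(4) by (simp add: k_def power2_eq_square algebra_simps abs_sgn)
    hence "e * k > 0" using assms by simp
    hence sk: "sgn k = sgn e" by (auto simp: zero_less_mult_iff)
    have "(n - k)\<^sup>2 + \<bar>k\<bar> * \<delta> = n\<^sup>2 - k * (2 * n - k - sgn e * \<delta>)"
      using sk by (simp add: power2_eq_square algebra_simps abs_sgn)
    also have "2 * n - k - sgn e * \<delta> = e" by (simp add: k_def)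
    finally have "(n - k)\<^sup>2 + \<bar>k\<bar> * \<delta> = N" using ek by (simp add: algebra_simps)
    moreover have "k \<noteq> 0" using \<open>e * k > 0\<close> by auto
    ultimately show ?thesis using e sk by (simp add: fiber_def k_def [symmetric])
  qed
  fix x assume "x \<in> fiber N n"
  moreover obtain e \<delta> where x: "x = (e, \<delta>)" by (cases x)
  ultimately have *: "(e, \<delta>) \<in> fiber N n" by simp
  show "(case x of (e, \<delta>) \<Rightarrow> (2 * n - e - sgn e * \<delta>, \<delta>)) \<in> fiber N n"
    using key[OF *] x by simp
  show "(case case x of (e, \<delta>) \<Rightarrow> (2 * n - e - sgn e * \<delta>, \<delta>) of
      (e, \<delta>) \<Rightarrow> (2 * n - e - sgn e * \<delta>, \<delta>)) = x"
    using key[OF *] x by simp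
  have "parity_sgn (2 * n - e - sgn e * \<delta>) = - parity_sgn e"
    using * by (auto simp: fiber_def parity_sgn_def sgn_if)
  thus "(case case x of (e, \<delta>) \<Rightarrow> (2 * n - e - sgn e * \<delta>, \<delta>) of (e, \<delta>) \<Rightarrow> sgn e * parity_sgn e) =
      - (case x of (e, \<delta>) \<Rightarrow> sgn e * parity_sgn e)"
    using key[OF *] x by simp
qed

text \<open>
  If \<open>n\<^sup>2 < N\<close>, replace \<open>k\<close> by \<open>-k\<close>, so that \<open>e\<close> and \<open>k\<close> have the same sign. Exchanging them may lead to a
  negative \<open>\<delta>\<close>; exactly in that case \<open>(-e, -\<delta>)\<close> is again in the fiber and serves as partner.
\<close>

lemma fiber_sum_neg:
  assumes "n\<^sup>2 < N"
  shows "(\<Sum>(e, \<delta>) \<in> fiber N n. sgn e * parity_sgn e) = 0"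
proof -
  \<comment> \<open>The value \<open>\<delta>'\<close> is forced by exchanging \<open>e\<close> with
    \<open>k = e + sgn e * \<delta> - 2 * n\<close>: it solves
    \<open>e = k + sgn e * \<delta>' - 2 * n\<close>.\<close>
  define i where "i = (\<lambda>(e, \<delta>). let \<delta>' = sgn e * (4 * n) - \<delta> in
    if \<delta>' > 0 then (e + sgn e * \<delta> - 2 * n, \<delta>') else (- e, - \<delta>'))"
  have key: "sgn (e + sgn e * \<delta> - 2 * n) = sgn e" "parity_sgn (e + sgn e * \<delta> - 2 * n) = - parity_sgn e"
      "sgn e * (4 * n) - \<delta> \<noteq> 0" "i (e, \<delta>) \<in> fiber N n"
    if "(e, \<delta>) \<in> fiber N n" for e \<delta>
  proof -
    define k where "k = e + sgn e * \<delta> - 2 * n"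
    define \<delta>' where "\<delta>' = sgn e * (4 * n) - \<delta>"
    have e: "e \<noteq> 0" "0 < \<delta>" "odd \<delta>" "(n - e)\<^sup>2 + \<bar>e\<bar> * \<delta> = N" using that by (auto simp: fiber_def)
    have ek: "e * k = N - n\<^sup>2"
      using e(4) by (simp add: k_def power2_eq_square algebra_simps abs_sgn)
    hence "e * k > 0" using assms by simp
    hence sk: "sgn k = sgn e" "k \<noteq> 0" by (auto simp: zero_less_mult_iff)
    thus "sgn (e + sgn e * \<delta> - 2 * n) = sgn e" by (simp add: k_def)
    show "parity_sgn (e + sgn e * \<delta> - 2 * n) = - parity_sgn e"
      using e by (auto simp: parity_sgn_def sgn_if)
    have "odd \<delta>'" using e by (simp add: \<delta>'_def)
    thus nz: "sgn e * (4 * n) - \<delta> \<noteq> 0" unfolding \<delta>'_def by fastforce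
    have ss: "sgn e * sgn e = 1" using e by (auto simp: sgn_if)
    have "(n - k)\<^sup>2 + \<bar>k\<bar> * \<delta>' = n\<^sup>2 - k * (2 * n - k - sgn e * \<delta>')"
      using sk by (simp add: power2_eq_square algebra_simps abs_sgn)
    also have "sgn e * \<delta>' = 4 * n - sgn e * \<delta>"
      using e by (simp add: \<delta>'_def right_diff_distrib mult.assoc [symmetric] ss)
    hence "2 * n - k - sgn e * \<delta>' = - e" by (simp add: k_def)
    finally have 1: "(n - k)\<^sup>2 + \<bar>k\<bar> * \<delta>' = N" using ek by (simp add: algebra_simps)
    have "(n - (- e))\<^sup>2 + \<bar>- e\<bar> * (- \<delta>') = (n - e)\<^sup>2 + \<bar>e\<bar> * \<delta> + (4 * n * e - \<bar>e\<bar> * sgn e * (4 * n))"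
      by (simp add: \<delta>'_def power2_eq_square algebra_simps)
    also have "\<bar>e\<bar> * sgn e = e" by (simp add: sgn_if)
    finally have 2: "(n - (- e))\<^sup>2 + \<bar>- e\<bar> * (- \<delta>') = N" using e by simp
    have "i (e, \<delta>) = (if \<delta>' > 0 then (k, \<delta>') else (- e, - \<delta>'))"
      by (simp add: i_def Let_def k_def \<delta>'_def)
    moreover have "\<delta>' \<noteq> 0" using nz by (simp add: \<delta>'_def)
    ultimately show "i (e, \<delta>) \<in> fiber N n"
      using 1 2 e sk \<open>odd \<delta>'\<close> by (auto simp: fiber_def)
  qed
  show ?thesis
  proof (rule sum_antisym_bij_eq_0 [where i = i])
    fix x assume "x \<in> fiber N n"
    moreover obtain e \<delta> where x: "x = (e, \<delta>)" by (cases x)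
    ultimately have *: "(e, \<delta>) \<in> fiber N n" by simp
    show "i x \<in> fiber N n" using key(4)[OF *] x by simp
    have ss: "sgn e * sgn e = 1" "\<delta> > 0" using * by (auto simp: sgn_if fiber_def)
    have ss': "sgn e * (sgn e * z) = z" for z using ss by (simp add: mult.assoc [symmetric])
    \<comment> \<open>Recomputing \<open>\<delta>'\<close> at the image gives
      \<open>\<delta>\<close> after the first branch and \<open>- \<delta>\<close> after the second,
      so the same branch is taken again. The first branch flips the parity of \<open>e\<close>, the
      second its sign.\<close>
    show "i (i x) = x"
      using key(1)[OF *] ss(2) by (auto simp: x i_def Let_def right_diff_distrib ss')
    show "(case i x of (e, \<delta>) \<Rightarrow> sgn e * parity_sgn e) = - (case x of (e, \<delta>) \<Rightarrow> sgn e * parity_sgn e)"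
      using key(1,2)[OF *] by (simp add: x i_def Let_def)
  qed
qed

text \<open>Now the product of \<open>e\<close> and \<open>2 * n - e - sgn e * \<delta>\<close> is
  zero, so \<open>sgn e * \<delta> = 2 * n - e\<close>. This forces \<open>e\<close> to be odd with
  \<open>0 < e < 2 * n\<close>, and each of these \<open>n\<close> values contributes
  \<open>-1\<close>.\<close>

lemma fiber_sum_zero_pos:
  assumes "n > 0"
  shows "(\<Sum>(e, \<delta>) \<in> fiber (n\<^sup>2) n. sgn e * parity_sgn e) = - n"
proof -
  have "fiber (n\<^sup>2) n = (\<lambda>i. (2 * i + 1, 2 * n - 2 * i - 1)) ` {0..<n}"
  proof (intro equalityI subsetI)
    fix x assume "x \<in> fiber (n\<^sup>2) n"
    then obtain e \<delta> where x: "x = (e, \<delta>)"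
      and e: "e \<noteq> 0" "0 < \<delta>" "odd \<delta>" "(n - e)\<^sup>2 + \<bar>e\<bar> * \<delta> = n\<^sup>2" by (auto simp: fiber_def)
    have "e * (2 * n - e - sgn e * \<delta>) = 0"
      using e(4) by (simp add: power2_eq_square algebra_simps abs_sgn)
    hence d: "sgn e * \<delta> = 2 * n - e" using e by simp
    have "e > 0" using d e assms by (cases "e > 0") (auto simp: sgn_if)
    hence d: "\<delta> = 2 * n - e" using d by simp
    hence "odd e" using e by simp
    then obtain i where "e = 2 * i + 1" by (elim oddE)
    thus "x \<in> (\<lambda>i. (2 * i + 1, 2 * n - 2 * i - 1)) ` {0..<n}"
      using x d e \<open>e > 0\<close> by (auto intro!: image_eqI [of _ _ i])
  next
    fix x assume "x \<in> (\<lambda>i. (2 * i + 1, 2 * n - 2 * i - 1)) ` {0..<n}"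
    then obtain i where "0 \<le> i" "i < n" "x = (2 * i + 1, 2 * n - 2 * i - 1)" by auto
    thus "x \<in> fiber (n\<^sup>2) n"
      by (simp add: fiber_def power2_eq_square algebra_simps)
  qed
  moreover have "inj_on (\<lambda>i. (2 * i + 1, 2 * n - 2 * i - 1)) {0..<n}" by (auto simp: inj_on_def)
  ultimately have "(\<Sum>(e, \<delta>) \<in> fiber (n\<^sup>2) n. sgn e * parity_sgn e) = (\<Sum>i\<in>{0..<n}. -1)"
    by (simp add: sum.reindex parity_sgn_def)
  thus ?thesis using assms by simp
qed

lemma fiber_sum_uminus:
  "(\<Sum>(e, \<delta>) \<in> fiber N (- n). sgn e * parity_sgn e) = - (\<Sum>(e, \<delta>) \<in> fiber N n. sgn e * parity_sgn e)"
proof -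
  have "(\<Sum>(e, \<delta>) \<in> fiber N (- n). sgn e * parity_sgn e) = (\<Sum>(e, \<delta>) \<in> fiber N n. - (sgn e * parity_sgn e))"
    by (rule sum.reindex_bij_witness [of _ "\<lambda>(e, \<delta>). (- e, \<delta>)" "\<lambda>(e, \<delta>). (- e, \<delta>)"])
      (auto simp: fiber_def power2_eq_square algebra_simps)
  thus ?thesis by (simp add: sum_negf case_prod_unfold)
qed

lemma fiber_sum_zero: "(\<Sum>(e, \<delta>) \<in> fiber (n\<^sup>2) n. sgn e * parity_sgn e) = - n"
proof -
  consider "n > 0" | "n = 0" | "n < 0" by linarith
  thus ?thesis
  proof cases
    case 1
    thus ?thesis by (rule fiber_sum_zero_pos)
  next
    case 2
    have "fiber 0 0 = {}"
      by (auto simp: fiber_def) (smt (verit) mult_pos_pos zero_le_power2)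
    thus ?thesis using 2 by simp
  next
    case 3
    thus ?thesis
      using fiber_sum_zero_pos [of "- n"] fiber_sum_uminus [of "n\<^sup>2" n] by simp
  qed
qed

lemma fiber_sum:
  "(\<Sum>(e, \<delta>) \<in> fiber N n. sgn e * parity_sgn e) = (if n\<^sup>2 = N then - n else 0)"
  using fiber_sum_pos [of N n] fiber_sum_neg [of n N] fiber_sum_zero [of n]
  by (cases "n\<^sup>2" N rule: linorder_cases) auto

definition square_plus_product :: "int \<Rightarrow> (int \<times> int \<times> int) set" where
  "square_plus_product N = {(m, d, \<delta>). 0 < d \<and> 0 < \<delta> \<and> odd \<delta> \<and> m\<^sup>2 + d * \<delta> = N}"

lemma abs_le_power2: "\<bar>n\<bar> \<le> (n::int)\<^sup>2"
proof -
  have "\<bar>n\<bar> * 1 \<le> \<bar>n\<bar> * \<bar>n\<bar>" by (cases "n = 0", simp, intro mult_left_mono) auto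
  thus ?thesis by (simp add: power2_eq_square del: abs_mult_self_eq)
qed

lemma square_plus_product_bounds:
  assumes "(m, d, \<delta>) \<in> square_plus_product N"
  shows "\<bar>m\<bar> \<le> N" "d \<le> N" "\<delta> \<le> N"
proof -
  have *: "0 < d" "0 < \<delta>" "m\<^sup>2 + d * \<delta> = N" using assms by (auto simp: square_plus_product_def)
  have "\<bar>m\<bar> \<le> m\<^sup>2" by (rule abs_le_power2)
  moreover have "d \<le> d * \<delta>" "\<delta> \<le> d * \<delta>" using * by simp_all
  moreover have "0 \<le> m\<^sup>2" by simp
  ultimately show "\<bar>m\<bar> \<le> N" "d \<le> N" "\<delta> \<le> N" using * by linarith+
qed

lemma finite_square_plus_product: "finite (square_plus_product N)"
proof (rule finite_subset)
  show "square_plus_product N \<subseteq> {- N..N} \<times> {0..N} \<times> {0..N}"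
    using square_plus_product_bounds [of _ _ _ N] by (fastforce simp: square_plus_product_def abs_le_iff)
qed simp

text \<open>Sorting the left side by the argument \<open>n = m - d\<close> or
  \<open>n = m + d\<close> of \<open>f\<close> gives \<open>f n\<close> a coefficient that is a
  signed sum over \<open>fiber N n\<close>, so \<open>fiber_sum\<close> leaves only the
  \<open>n\<close> with \<open>n\<^sup>2 = N\<close>.\<close>

lemma liouville:
  fixes f :: "int \<Rightarrow> int"
  shows "(\<Sum>(m, d, \<delta>) \<in> square_plus_product N. parity_sgn m * (f (m - d) - f (m + d))) = (\<Sum>n | n\<^sup>2 = N. parity_sgn n * n * f n)"
proof -
  define R where "R = {- 2 * N..2 * N}"
  define w where "w = (\<lambda>(n, e, \<delta> :: int). - parity_sgn (n - e) * sgn e * f n)"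
  have finR: "finite (fiber N n)" for n
  proof (rule finite_subset)
    show "fiber N n \<subseteq> (\<lambda>(m, d, \<delta>). (d, \<delta>)) ` square_plus_product N \<union> (\<lambda>(m, d, \<delta>). (- d, \<delta>)) ` square_plus_product N"
    proof
      fix x assume "x \<in> fiber N n"
      then obtain e \<delta> where x: "x = (e, \<delta>)"
        "e \<noteq> 0" "0 < \<delta>" "odd \<delta>" "(n - e)\<^sup>2 + \<bar>e\<bar> * \<delta> = N" by (auto simp: fiber_def)
      hence "(n - e, \<bar>e\<bar>, \<delta>) \<in> square_plus_product N" by (simp add: square_plus_product_def)
      hence "(\<bar>e\<bar>, \<delta>) \<in> (\<lambda>(m, d, \<delta>). (d, \<delta>)) ` square_plus_product N" "(- \<bar>e\<bar>, \<delta>) \<in> (\<lambda>(m, d, \<delta>). (- d, \<delta>)) ` square_plus_product N"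
        by force+
      thus "x \<in> (\<lambda>(m, d, \<delta>). (d, \<delta>)) ` square_plus_product N \<union> (\<lambda>(m, d, \<delta>). (- d, \<delta>)) ` square_plus_product N"
        using x by (cases "e > 0") auto
    qed
  qed (simp add: finite_square_plus_product)
  have Rneg: "n + d \<in> R" "n - d \<in> R" if "(n, d, \<delta>) \<in> square_plus_product N" for n d \<delta>
    using square_plus_product_bounds [OF that] that by (auto simp: R_def square_plus_product_def)
  have "(\<Sum>(m, d, \<delta>) \<in> square_plus_product N. parity_sgn m * (f (m - d) - f (m + d)))
      = (\<Sum>(m, d, \<delta>) \<in> square_plus_product N. parity_sgn m * f (m - d)) + (\<Sum>(m, d, \<delta>) \<in> square_plus_product N. - parity_sgn m * f (m + d))"
    by (simp add: sum.distrib [symmetric] case_prod_unfold algebra_simps)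
  also have "(\<Sum>(m, d, \<delta>) \<in> square_plus_product N. parity_sgn m * f (m - d)) = sum w {(n, e, \<delta>) \<in> Sigma R (fiber N). e < 0}"
    by (rule sum.reindex_bij_witness [of _ "\<lambda>(n, e, \<delta>). (n - e, - e, \<delta>)" "\<lambda>(m, d, \<delta>). (m - d, - d, \<delta>)"])
      (use Rneg in \<open>auto simp: square_plus_product_def fiber_def w_def\<close>)
  also have "(\<Sum>(m, d, \<delta>) \<in> square_plus_product N. - parity_sgn m * f (m + d)) = sum w {(n, e, \<delta>) \<in> Sigma R (fiber N). \<not> e < 0}"
    by (rule sum.reindex_bij_witness [of _ "\<lambda>(n, e, \<delta>). (n - e, e, \<delta>)" "\<lambda>(m, d, \<delta>). (m + d, d, \<delta>)"])
      (use Rneg in \<open>auto simp: square_plus_product_def fiber_def w_def\<close>)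
  also have "sum w {(n, e, \<delta>) \<in> Sigma R (fiber N). e < 0} + sum w {(n, e, \<delta>) \<in> Sigma R (fiber N). \<not> e < 0}
      = sum w (Sigma R (fiber N))"
    by (subst sum.union_disjoint [symmetric])
      (auto intro!: sum.cong intro: finite_subset [OF _ finite_SigmaI [of R "fiber N"]] simp: finR R_def)
  also have "\<dots> = (\<Sum>n\<in>R. \<Sum>x\<in>fiber N n. w (n, x))"
    by (simp add: sum.Sigma finR R_def)
  also have "\<dots> = (\<Sum>n\<in>R. - parity_sgn n * f n * (\<Sum>(e, \<delta>) \<in> fiber N n. sgn e * parity_sgn e))"
    by (simp add: w_def sum_distrib_left case_prod_unfold parity_sgn_diff algebra_simps)
  also have "\<dots> = (\<Sum>n | n\<^sup>2 = N. parity_sgn n * n * f n)"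
  proof (rule sum.mono_neutral_cong_right)
    show "{n. n\<^sup>2 = N} \<subseteq> R"
    proof
      fix n assume "n \<in> {n. n\<^sup>2 = N}"
      hence "\<bar>n\<bar> \<le> N" using abs_le_power2 [of n] by simp
      thus "n \<in> R" by (auto simp: R_def)
    qed
  qed (auto simp: R_def fiber_sum)
  finally show ?thesis .
qed

section \<open>Theta series and Lambert series\<close>

definition theta :: "(int \<Rightarrow> int) \<Rightarrow> int fps" where
  "theta c = wsum UNIV (\<lambda>n. nat (n\<^sup>2)) c"

definition sig :: "nat \<Rightarrow> int fps" where
  "sig k = Abs_fps (\<lambda>n. int (divisor_sum k n))"

definition odd_sig :: "nat \<Rightarrow> int fps" where
  "odd_sig k = sig k - dil (sig k)"

text \<open>The divisors of an even \<open>n\<close> with even cofactor are the divisors of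
  \<open>n div 2\<close>, and subtracting \<open>dil (sig k)\<close> removes them; an odd
  \<open>n\<close> has none.\<close>

lemma odd_sig_wsum:
  "odd_sig k = wsum {(d, \<delta>). 0 < d \<and> 0 < \<delta> \<and> odd \<delta>} (\<lambda>(d, \<delta>). nat (d * \<delta>)) (\<lambda>(d, \<delta>). d ^ k)"
proof (rule fps_ext)
  fix n
  show "odd_sig k $ n = wsum {(d, \<delta>). 0 < d \<and> 0 < \<delta> \<and> odd \<delta>} (\<lambda>(d, \<delta>). nat (d * \<delta>)) (\<lambda>(d, \<delta>). d ^ k) $ n"
  proof (cases "n = 0")
    case True
    have "divisor_sum k 0 = 0" by (simp add: divisor_sum_def)
    moreover have "(\<Sum>i | i \<in> {(d, \<delta>). 0 < d \<and> 0 < \<delta> \<and> odd \<delta>} \<and> (case i of (d, \<delta>) \<Rightarrow> nat (d * \<delta>)) = 0.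
        case i of (d, \<delta>) \<Rightarrow> d ^ k) = 0"
      by (rule sum.neutral) (auto simp: mult_le_0_iff)
    ultimately show ?thesis using True
      unfolding odd_sig_def sig_def wsum_def fps_sub_nth dil_nth fps_nth_Abs_fps by simp
  next
    case False
    define A where "A = {d. d dvd n \<and> odd (n div d)}"
    define B where "B = {d. d dvd n \<and> even (n div d)}"
    have fin: "finite {d. d dvd n}" using False by simp
    have "int (divisor_sum k n) = (\<Sum>d\<in>A \<union> B. int d ^ k)"
      by (simp add: divisor_sum_def A_def B_def) (rule sum.cong, auto)
    also have "\<dots> = (\<Sum>d\<in>A. int d ^ k) + (\<Sum>d\<in>B. int d ^ k)"
      by (rule sum.union_disjoint)
        (auto simp: A_def B_def intro: finite_subset [OF _ fin])
    finally have 1: "int (divisor_sum k n) = (\<Sum>d\<in>A. int d ^ k) + (\<Sum>d\<in>B. int d ^ k)" .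
    have "dil (sig k) $ n = (\<Sum>d\<in>B. int d ^ k)"
    proof (cases "even n")
      case True
      then obtain m where m: "n = 2 * m" by (elim evenE)
      have "B = {d. d dvd m}"
      proof (intro equalityI subsetI CollectI)
        fix d assume "d \<in> B"
        hence "d dvd n" "even (n div d)" by (simp_all add: B_def)
        moreover from \<open>d dvd n\<close> obtain k where "n = d * k" by (rule dvdE)
        moreover from this \<open>n \<noteq> 0\<close> \<open>even (n div d)\<close> have "even k" by auto
        ultimately show "d dvd m" using m by (auto elim!: evenE)
      qed (use False in \<open>auto simp: B_def m elim!: dvdE\<close>)
      thus ?thesis by (simp add: dil_nth sig_def m divisor_sum_def)
    next
      case False
      hence "B = {}" unfolding B_def by (metis (mono_tags, lifting) Collect_empty_eq dvd_div_mult_self dvd_mult2)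
      thus ?thesis using False by (simp add: dil_nth)
    qed
    hence "odd_sig k $ n = (\<Sum>d\<in>A. int d ^ k)"
      using 1 by (simp add: odd_sig_def sig_def)
    also have "\<dots> = wsum {(d, \<delta>). 0 < d \<and> 0 < \<delta> \<and> odd \<delta>} (\<lambda>(d, \<delta>). nat (d * \<delta>)) (\<lambda>(d, \<delta>). d ^ k) $ n"
      unfolding wsum_def fps_nth_Abs_fps
    proof (rule sum.reindex_bij_witness [of _ "\<lambda>(d, \<delta>). nat d" "\<lambda>d. (int d, int (n div d))"])
      fix d assume "d \<in> A"
      then obtain e where "n = d * e" "odd e" "d > 0" using False by (auto simp: A_def elim!: dvdE)
      thus "(int d, int (n div d)) \<in> {i \<in> {(d, \<delta>). 0 < d \<and> 0 < \<delta> \<and> odd \<delta>}. (case i of (d, \<delta>) \<Rightarrow> nat (d * \<delta>)) = n}"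
        by (auto simp: nat_mult_distrib odd_pos)
    next
      fix x assume "x \<in> {i \<in> {(d, \<delta>::int). 0 < d \<and> 0 < \<delta> \<and> odd \<delta>}. (case i of (d, \<delta>) \<Rightarrow> nat (d * \<delta>)) = n}"
      then obtain d e where x: "x = (d, e)" "0 < d" "0 < e" "odd e" "n = nat (d * e)" by auto
      hence "n = nat d * nat e" by (simp add: nat_mult_distrib)
      moreover have "odd (nat e)" using x by (simp add: even_nat_iff)
      ultimately show "(case x of (d, \<delta>) \<Rightarrow> nat d) \<in> A"
        "(int (case x of (d, \<delta>) \<Rightarrow> nat d), int (n div (case x of (d, \<delta>) \<Rightarrow> nat d))) = x"
        using x by (auto simp: A_def)
    qed (auto simp: A_def)
    finally show ?thesis .
  qed
qed

lemma finite_sq_fiber: "finite {n \<in> UNIV. nat ((n::int)\<^sup>2) = N}"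
proof (rule finite_subset)
  show "{n \<in> UNIV. nat ((n::int)\<^sup>2) = N} \<subseteq> {- int N..int N}"
  proof
    fix n :: int assume "n \<in> {n \<in> UNIV. nat (n\<^sup>2) = N}"
    hence "n\<^sup>2 = int N" by (auto simp: nat_eq_iff)
    thus "n \<in> {- int N..int N}" using abs_le_power2 [of n] by auto
  qed
qed simp

lemma finite_prod_fiber: "finite {i \<in> {(d, \<delta>). 0 < d \<and> 0 < \<delta> \<and> odd \<delta>}. (case i of (d, \<delta>) \<Rightarrow> nat (d * \<delta>)) = N}"
proof (rule finite_subset)
  show "{i \<in> {(d, \<delta>). 0 < d \<and> 0 < \<delta> \<and> odd \<delta>}. (case i of (d, \<delta>) \<Rightarrow> nat (d * \<delta>)) = N} \<subseteq> {0..int N} \<times> {0..int N}"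
  proof clarify
    fix d e :: int assume "0 < d" "0 < e" "odd e" "N = nat (d * e)"
    moreover from this have "d * 1 \<le> d * e" "1 * e \<le> d * e" by (intro mult_mono; simp)+
    ultimately show "d \<in> {0..int (nat (d * e))} \<and> e \<in> {0..int (nat (d * e))}" by simp
  qed
qed simp

lemma nat_add_eq_iff: "0 \<le> a \<Longrightarrow> 0 \<le> b \<Longrightarrow> nat a + nat b = N \<longleftrightarrow> a + b = int N"
  by auto

lemma theta_odd_sig_nth:
  "(theta c * odd_sig k) $ N = (\<Sum>(m, d, \<delta>) \<in> square_plus_product (int N). c m * d ^ k)"
  unfolding theta_def odd_sig_wsum wsum_mult [OF finite_sq_fiber finite_prod_fiber]
  unfolding wsum_def fps_nth_Abs_fps
  by (rule sum.cong) (auto simp: square_plus_product_def nat_add_eq_iff)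

lemma theta_nth: "theta c $ N = (\<Sum>n | n\<^sup>2 = int N. c n)"
  by (auto simp: theta_def wsum_def nat_eq_iff intro!: sum.cong)

text \<open>When the difference of \<open>f\<close> is polynomial in \<open>d\<close>, the sum over
  \<open>m\<^sup>2 + d * \<delta> = N\<close> separates into products of a theta series in
  \<open>m\<close> and a Lambert series in \<open>d\<close>.\<close>

lemma liouville_fps:
  assumes "\<And>m d. f (m + d) - f (m - d) = (\<Sum>i\<in>I. a i m * d ^ k i)"
  shows "theta (\<lambda>n. parity_sgn n * n * f n) = - (\<Sum>i\<in>I. theta (\<lambda>m. parity_sgn m * a i m) * odd_sig (k i))"
proof (rule fps_ext)
  fix N
  have "(\<Sum>i\<in>I. theta (\<lambda>m. parity_sgn m * a i m) * odd_sig (k i)) $ N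
      = (\<Sum>i\<in>I. \<Sum>(m, d, \<delta>) \<in> square_plus_product (int N). parity_sgn m * a i m * d ^ k i)"
    by (simp add: fps_sum_nth theta_odd_sig_nth)
  also have "\<dots> = (\<Sum>(m, d, \<delta>) \<in> square_plus_product (int N). parity_sgn m * (f (m + d) - f (m - d)))"
    by (subst sum.swap) (simp add: assms sum_distrib_left case_prod_unfold mult.assoc)
  also have "\<dots> = - (\<Sum>(m, d, \<delta>) \<in> square_plus_product (int N). parity_sgn m * (f (m - d) - f (m + d)))"
    by (simp add: sum_negf [symmetric] case_prod_unfold algebra_simps)
  also have "\<dots> = - theta (\<lambda>n. parity_sgn n * n * f n) $ N"
    by (simp add: liouville theta_nth)
  finally show "theta (\<lambda>n. parity_sgn n * n * f n) $ N = (- (\<Sum>i\<in>I. theta (\<lambda>m. parity_sgn m * a i m) * odd_sig (k i))) $ N"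
    by simp
qed

section \<open>Derivatives of theta series\<close>

lemma qderiv_theta: "qderiv (theta c) = theta (\<lambda>n. n\<^sup>2 * c n)"
  by (rule fps_ext) (simp add: qderiv_nth theta_nth sum_distrib_left)

lemma theta_cmult: "theta (\<lambda>n. parity_sgn n * (numeral k * c n)) = numeral k * theta (\<lambda>n. c n * parity_sgn n)"
  by (rule fps_ext)
    (simp add: theta_nth sum_distrib_left numeral_fps_const fps_mult_left_const_nth mult_ac)

definition theta4 :: "int fps" where "theta4 = theta parity_sgn"
definition theta3 :: "int fps" where "theta3 = theta (\<lambda>_. 1)"

text \<open>This and the next two derivatives use the test functions \<open>n\<close>,
  \<open>n ^ 3\<close> and \<open>n ^ 5\<close>, whose differences are \<open>2 d\<close>,
  \<open>6 m^2 d + 2 d^3\<close> and \<open>10 m^4 d + 20 m^2 d^3 + 2 d^5\<close>. Each factor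
  \<open>m^2\<close> becomes one \<open>qderiv\<close>.\<close>

lemma qderiv_theta4: "qderiv theta4 = - (2 * theta4 * odd_sig 1)"
proof -
  have "qderiv theta4 = theta (\<lambda>n. parity_sgn n * n * n)"
    unfolding theta4_def qderiv_theta by (simp add: power2_eq_square mult_ac)
  \<comment> \<open>The factor \<open>2 * 1\<close> matches the pattern of
    \<open>theta_cmult\<close> with constant weight \<open>1\<close>.\<close>
  also have "\<dots> = - (\<Sum>i\<in>{()}. theta (\<lambda>m. parity_sgn m * (2 * 1)) * odd_sig 1)"
    by (rule liouville_fps) simp
  finally show ?thesis unfolding theta_cmult by (simp add: theta4_def)
qed

lemma qderiv2_theta4: "qderiv (qderiv theta4) = - (6 * qderiv theta4 * odd_sig 1 + 2 * theta4 * odd_sig 3)"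
proof -
  have "qderiv (qderiv theta4) = theta (\<lambda>n. parity_sgn n * n * n ^ 3)"
    unfolding theta4_def qderiv_theta by (simp add: power2_eq_square power3_eq_cube mult_ac)
  also have "\<dots> = - (\<Sum>i\<in>{0, 1::nat}. theta (\<lambda>m. parity_sgn m * ([6 * m\<^sup>2, 2 * 1] ! i)) * odd_sig ([1, 3] ! i))"
    by (rule liouville_fps) (simp add: power3_eq_cube power2_eq_square algebra_simps)
  also have "\<dots> = - (theta (\<lambda>m. parity_sgn m * (6 * m\<^sup>2)) * odd_sig 1 + theta (\<lambda>m. parity_sgn m * (2 * 1)) * odd_sig 3)"
    by simp
  finally show ?thesis unfolding theta_cmult by (simp add: theta4_def qderiv_theta)
qed

lemma qderiv3_theta4: "qderiv (qderiv (qderiv theta4)) =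
  - (10 * qderiv (qderiv theta4) * odd_sig 1 + 20 * qderiv theta4 * odd_sig 3 + 2 * theta4 * odd_sig 5)"
proof -
  have "qderiv (qderiv (qderiv theta4)) = theta (\<lambda>n. parity_sgn n * n * n ^ 5)"
    unfolding theta4_def qderiv_theta by (simp add: numeral_eq_Suc mult_ac)
  also have "\<dots> = - (\<Sum>i\<in>{0, 1, 2::nat}. theta (\<lambda>m. parity_sgn m * ([10 * m ^ 4, 20 * m\<^sup>2, 2 * 1] ! i)) * odd_sig ([1, 3, 5] ! i))"
    by (rule liouville_fps) (simp add: numeral_eq_Suc algebra_simps)
  also have "\<dots> = - (theta (\<lambda>m. parity_sgn m * (10 * m ^ 4)) * odd_sig 1 + theta (\<lambda>m. parity_sgn m * (20 * m\<^sup>2)) * odd_sig 3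
      + theta (\<lambda>m. parity_sgn m * (2 * 1)) * odd_sig 5)"
    by (simp add: add.assoc)
  also have "(\<lambda>m. parity_sgn m * (10 * m ^ 4)) = (\<lambda>m. parity_sgn m * (10 * (m\<^sup>2 * m\<^sup>2)))"
    by (simp add: power_add [symmetric])
  finally show ?thesis unfolding theta_cmult by (simp add: theta4_def qderiv_theta mult.assoc)
qed

section \<open>Doubling formulas from sums of two squares\<close>

lemma theta_mult_nth:
  "(theta c * theta c') $ N = (\<Sum>(m, n) | m\<^sup>2 + n\<^sup>2 = int N. c m * c' n)"
  unfolding theta_def wsum_mult [OF finite_sq_fiber finite_sq_fiber]
  unfolding wsum_def fps_nth_Abs_fps
  by (rule sum.cong) (auto simp: nat_add_eq_iff)

lemma theta_power2_nth: "(theta c)\<^sup>2 $ N = (\<Sum>(m, n) | m\<^sup>2 + n\<^sup>2 = int N. c m * c n)"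
  unfolding power2_eq_square [of "theta c"] by (rule theta_mult_nth)

text \<open>If \<open>m\<^sup>2 + n\<^sup>2\<close> is even, then \<open>m\<close> and
  \<open>n\<close> have equal parity, so \<open>(m, n)\<close> is the image of an integral point
  under \<open>(u, v) \<mapsto> (u + v, u - v)\<close>, which doubles the sum of squares.\<close>

lemma sum_two_squares_double:
  "(\<Sum>(m, n) | m\<^sup>2 + n\<^sup>2 = 2 * N. h m n) = (\<Sum>(u, v) | u\<^sup>2 + v\<^sup>2 = N. h (u + v) (u - v))"
  for h :: "int \<Rightarrow> int \<Rightarrow> int"
proof (rule sum.reindex_bij_witness [of _ "\<lambda>(u, v). (u + v, u - v)" "\<lambda>(m, n). ((m + n) div 2, (m - n) div 2)"])
  fix x assume "x \<in> {(m, n). m\<^sup>2 + n\<^sup>2 = 2 * N}"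
  then obtain m n where x: "x = (m, n)" "m\<^sup>2 + n\<^sup>2 = 2 * N" by auto
  have "even (m\<^sup>2 + n\<^sup>2)" using x by simp
  hence "even (m + n)" by simp
  then obtain u where u: "m = 2 * u - n" by (metis add_diff_cancel_right' evenE)
  have d: "(m + n) div 2 = u" "(m - n) div 2 = u - n" unfolding u by simp_all
  have "u\<^sup>2 + (u - n)\<^sup>2 = N"
    using x(2) unfolding u power2_eq_square by (simp add: algebra_simps)
  thus "(case case x of (m, n) \<Rightarrow> ((m + n) div 2, (m - n) div 2) of (u, v) \<Rightarrow> (u + v, u - v)) = x"
    "(case x of (m, n) \<Rightarrow> ((m + n) div 2, (m - n) div 2)) \<in> {(u, v). u\<^sup>2 + v\<^sup>2 = N}"
    "(case case x of (m, n) \<Rightarrow> ((m + n) div 2, (m - n) div 2) of (u, v) \<Rightarrow> h (u + v) (u - v)) = (case x of (m, n) \<Rightarrow> h m n)"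
    by (simp_all add: x(1) d) (simp_all add: u)
next
  fix x assume "x \<in> {(u, v). u\<^sup>2 + v\<^sup>2 = N}"
  thus "(case case x of (u, v) \<Rightarrow> (u + v, u - v) of (m, n) \<Rightarrow> ((m + n) div 2, (m - n) div 2)) = x"
    "(case x of (u, v) \<Rightarrow> (u + v, u - v)) \<in> {(m, n). m\<^sup>2 + n\<^sup>2 = 2 * N}"
    by (auto simp: power2_eq_square algebra_simps)
qed

text \<open>At even exponents the sign of \<open>n = u - v\<close> is the product of the signs of
  \<open>u\<close> and \<open>v\<close>. At odd exponents exactly one of \<open>m\<close>,
  \<open>n\<close> is odd, and swapping them cancels the terms in pairs.\<close>

lemma theta3_theta4: "theta3 * theta4 = dil (theta4 ^ 2)"
proof (rule fps_ext)
  fix N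
  have *: "(theta3 * theta4) $ N = (\<Sum>(m, n) | m\<^sup>2 + n\<^sup>2 = int N. parity_sgn n)"
    by (simp add: theta3_def theta4_def theta_mult_nth)
  show "(theta3 * theta4) $ N = dil (theta4 ^ 2) $ N"
  proof (cases "even N")
    case True
    then obtain M where M: "N = 2 * M" by (elim evenE)
    have "(theta3 * theta4) $ N = (\<Sum>(u, v) | u\<^sup>2 + v\<^sup>2 = int M. parity_sgn u * parity_sgn v)"
      using sum_two_squares_double [where N = "int M" and h = "\<lambda>m n. parity_sgn n"] unfolding * by (simp add: M parity_sgn_diff)
    also have "\<dots> = (theta4 ^ 2) $ M"
      by (simp add: theta_power2_nth theta4_def)
    finally show ?thesis by (simp add: M dil_nth del: dil_power)
  next
    case False
    have "(\<Sum>(m, n) | m\<^sup>2 + n\<^sup>2 = int N. parity_sgn n) = 0"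
    proof (rule sum_antisym_bij_eq_0 [where i = prod.swap])
      fix x assume "x \<in> {(m, n). m\<^sup>2 + n\<^sup>2 = int N}"
      then obtain m n where x: "x = (m, n)" "m\<^sup>2 + n\<^sup>2 = int N" by auto
      have "odd (m\<^sup>2 + n\<^sup>2)" using x False by simp
      thus "(case prod.swap x of (m, n) \<Rightarrow> parity_sgn n) = - (case x of (m, n) \<Rightarrow> parity_sgn n)"
        by (auto simp: x(1) parity_sgn_def)
    qed (auto simp: add.commute)
    thus ?thesis using False * by (simp add: dil_nth del: dil_power)
  qed
qed

text \<open>The weight \<open>1 + parity_sgn m * parity_sgn n\<close> is \<open>2\<close> when
  \<open>m\<^sup>2 + n\<^sup>2\<close> is even, and the weights at an odd exponent are
  \<open>0\<close>.\<close>

lemma theta3_sq_theta4_sq: "theta3 ^ 2 + theta4 ^ 2 = 2 * dil (theta3 ^ 2)"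
proof (rule fps_ext)
  fix N
  have fin: "finite {(m, n). m\<^sup>2 + n\<^sup>2 = int N}"
  proof (rule finite_subset)
    show "{(m, n). m\<^sup>2 + n\<^sup>2 = int N} \<subseteq> {- int N..int N} \<times> {- int N..int N}"
    proof clarify
      fix m n assume "m\<^sup>2 + n\<^sup>2 = int N"
      moreover have "0 \<le> m\<^sup>2" "0 \<le> n\<^sup>2" by simp_all
      ultimately show "m \<in> {- int N..int N} \<and> n \<in> {- int N..int N}"
        using abs_le_power2 [of m] abs_le_power2 [of n] by auto
    qed
  qed simp
  have *: "(theta3 ^ 2 + theta4 ^ 2) $ N = (\<Sum>(m, n) | m\<^sup>2 + n\<^sup>2 = int N. 1 + parity_sgn m * parity_sgn n)"
    by (simp add: theta3_def theta4_def power2_eq_square [of "theta _"] theta_mult_nth sum.distrib case_prod_unfold)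
  show "(theta3 ^ 2 + theta4 ^ 2) $ N = (2 * dil (theta3 ^ 2)) $ N"
  proof (cases "even N")
    case True
    then obtain M where M: "N = 2 * M" by (elim evenE)
    have "parity_sgn u * parity_sgn u = 1" for u by (simp add: parity_sgn_def)
    hence sq: "parity_sgn (u + v) * parity_sgn (u - v) = 1" for u v by (simp add: parity_sgn_diff parity_sgn_add algebra_simps)
    have "(theta3 ^ 2 + theta4 ^ 2) $ N = (\<Sum>(u, v) | u\<^sup>2 + v\<^sup>2 = int M. 2 * (1 * 1))"
      using sum_two_squares_double [where N = "int M" and h = "\<lambda>m n. 1 + parity_sgn m * parity_sgn n"]
      unfolding * by (simp add: M sq)
    also have "\<dots> = 2 * (\<Sum>(u, v) | u\<^sup>2 + v\<^sup>2 = int M. 1 * 1)"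
      unfolding sum_distrib_left by (rule sum.cong) auto
    also have "\<dots> = 2 * (theta3 ^ 2) $ M"
      by (simp add: theta_power2_nth theta3_def)
    finally show ?thesis
      by (simp add: M dil_nth numeral_fps_const fps_mult_left_const_nth del: dil_power)
  next
    case False
    have "(\<Sum>(m, n) | m\<^sup>2 + n\<^sup>2 = int N. 1 + parity_sgn m * parity_sgn n) = 0"
    proof (rule sum.neutral, clarify)
      fix m n assume "m\<^sup>2 + n\<^sup>2 = int N"
      hence "odd (m\<^sup>2 + n\<^sup>2)" using False by simp
      thus "1 + parity_sgn m * parity_sgn n = 0" by (auto simp: parity_sgn_def)
    qed
    thus ?thesis using False * 
      by (simp add: dil_nth numeral_fps_const fps_mult_left_const_nth del: dil_power)
  qed
qed

section \<open>Modular identities of level 2\<close>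

definition dlog_theta4 :: "int fps" where "dlog_theta4 = - (2 * odd_sig 1)"
text \<open>This is the sum of \<open>sigma_1(n) q^n\<close> over odd \<open>n\<close>: for odd
  \<open>m\<close> the coefficient of \<open>odd_sig 1\<close> at \<open>2 ^ a * m\<close> is
  \<open>2 ^ a\<close> times the divisor sum of \<open>m\<close>, so even exponents cancel.\<close>

definition lambert_G :: "int fps" where "lambert_G = odd_sig 1 - 2 * dil (odd_sig 1)"
definition Jser :: "int fps" where "Jser = 1 + 24 * sig 1 - 48 * dil (sig 1)"
definition E6ser :: "int fps" where "E6ser = 1 - 504 * sig 5"

lemma fps_double_cancel: "2 * a = 2 * b \<Longrightarrow> a = (b :: int fps)"
  and fps_sixteen_cancel: "16 * a = 16 * b \<Longrightarrow> a = (b :: int fps)"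
  by simp_all

text \<open>For \<open>Jser\<close> and \<open>E6ser\<close> the difference \<open>f - dil f\<close>
  is a multiple of \<open>lambert_G\<close> or \<open>odd_sig 5\<close>, which is easier to reach
  than the series itself.\<close>

lemma dil_diff_eqI:
  fixes f :: "int fps"
  assumes "f - dil f = h" "g - dil g = h" "f $ 0 = g $ 0"
  shows "f = g"
proof (rule dil_eqI [where c = 1])
  have "f - g = (f - dil f) - (g - dil g) + dil (f - g)" by simp
  also have "\<dots> = 1 * dil (f - g)" unfolding assms(1,2) by simp
  finally show "f - g = 1 * dil (f - g)" .
qed fact

lemma theta4_nth_0: "theta4 $ 0 = 1" and theta3_nth_0: "theta3 $ 0 = 1"
  and theta4_nth_1: "theta4 $ Suc 0 = - 2" and theta3_nth_1: "theta3 $ Suc 0 = 2"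
proof -
  have "{n::int. n\<^sup>2 = 0} = {0}" "{n::int. n\<^sup>2 = 1} = {1, -1}"
    by (auto simp: power2_eq_1_iff)
  thus "theta4 $ 0 = 1" "theta3 $ 0 = 1" "theta4 $ Suc 0 = - 2" "theta3 $ Suc 0 = 2"
    by (simp_all add: theta4_def theta3_def theta_nth parity_sgn_def)
qed

text \<open>\<open>divisor_sum k 0\<close> is a sum over the infinite set of all divisors of \<open>0\<close>, hence \<open>0\<close> by convention.\<close>

lemma divisor_sum_0: "divisor_sum k 0 = 0" and divisor_sum_1: "divisor_sum k (Suc 0) = 1"
  by (simp_all add: divisor_sum_def)

lemma lambert_G_nth: "lambert_G $ 0 = 0" "lambert_G $ Suc 0 = 1"
  by (simp_all add: lambert_G_def odd_sig_def sig_def dil_nth divisor_sum_0 divisor_sum_1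
      numeral_fps_const fps_mult_left_const_nth)

lemma theta4_neq_0: "theta4 \<noteq> 0" and theta3_neq_0: "theta3 \<noteq> 0"
  using theta4_nth_0 theta3_nth_0 by auto

lemma qderiv_theta4': "qderiv theta4 = dlog_theta4 * theta4"
  by (simp add: qderiv_theta4 dlog_theta4_def algebra_simps)

text \<open>The second derivative of \<open>theta4\<close> is computed once from the logarithmic
  derivative and once from \<open>qderiv2_theta4\<close>; the factor \<open>theta4\<close> then
  cancels.\<close>

lemma qderiv_dlog_theta4: "qderiv dlog_theta4 = 2 * dlog_theta4 ^ 2 - 2 * odd_sig 3"
proof -
  have "theta4 * qderiv dlog_theta4 = qderiv (qderiv theta4) - dlog_theta4 * (dlog_theta4 * theta4)"
    by (simp add: qderiv_theta4')
  also have "qderiv (qderiv theta4) = 3 * dlog_theta4 * (dlog_theta4 * theta4) - 2 * theta4 * odd_sig 3"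
    by (subst qderiv2_theta4) (simp add: qderiv_theta4' dlog_theta4_def algebra_simps)
  also have "\<dots> - dlog_theta4 * (dlog_theta4 * theta4) = theta4 * (2 * dlog_theta4 ^ 2 - 2 * odd_sig 3)"
    by algebra
  finally show ?thesis using theta4_neq_0 by simp
qed

text \<open>The same comparison at third order; \<open>qderiv_dlog_theta4\<close> eliminates the
  derivatives of \<open>dlog_theta4\<close>.\<close>

lemma odd_sig_5: "odd_sig 5 = qderiv (odd_sig 3) - 8 * dlog_theta4 * odd_sig 3"
proof -
  have d: "qderiv (qderiv dlog_theta4) = 4 * dlog_theta4 * qderiv dlog_theta4 - 2 * qderiv (odd_sig 3)"
    unfolding qderiv_dlog_theta4 by (simp add: qderiv_dlog_theta4 power2_eq_square algebra_simps)
  have "theta4 * (qderiv (qderiv dlog_theta4) + 3 * dlog_theta4 * qderiv dlog_theta4 + dlog_theta4 ^ 3) = qderiv (qderiv (qderiv theta4))"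
    by (simp add: qderiv_theta4' power3_eq_cube algebra_simps)
  also have "\<dots> = theta4 * (5 * dlog_theta4 * (qderiv dlog_theta4 + dlog_theta4 ^ 2) - 20 * dlog_theta4 * odd_sig 3 - 2 * odd_sig 5)"
    by (subst qderiv3_theta4) (simp add: qderiv_theta4' dlog_theta4_def power2_eq_square algebra_simps)
  finally have "theta4 * (qderiv (qderiv dlog_theta4) + 3 * dlog_theta4 * qderiv dlog_theta4 + dlog_theta4 ^ 3)
      = theta4 * (5 * dlog_theta4 * (qderiv dlog_theta4 + dlog_theta4 ^ 2) - 20 * dlog_theta4 * odd_sig 3 - 2 * odd_sig 5)" .
  hence "qderiv (qderiv dlog_theta4) + 3 * dlog_theta4 * qderiv dlog_theta4 + dlog_theta4 ^ 3
      = 5 * dlog_theta4 * (qderiv dlog_theta4 + dlog_theta4 ^ 2) - 20 * dlog_theta4 * odd_sig 3 - 2 * odd_sig 5"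
    using theta4_neq_0 by simp
  hence "4 * dlog_theta4 * qderiv dlog_theta4 - 2 * qderiv (odd_sig 3) + 3 * dlog_theta4 * qderiv dlog_theta4 + dlog_theta4 ^ 3
      = 5 * dlog_theta4 * (qderiv dlog_theta4 + dlog_theta4 ^ 2) - 20 * dlog_theta4 * odd_sig 3 - 2 * odd_sig 5"
    unfolding d .
  note * = this [unfolded qderiv_dlog_theta4]
  have "2 * odd_sig 5 = 2 * odd_sig 5 + (5 * dlog_theta4 * (2 * dlog_theta4 ^ 2 - 2 * odd_sig 3 + dlog_theta4 ^ 2) - 20 * dlog_theta4 * odd_sig 3 - 2 * odd_sig 5)
      - (4 * dlog_theta4 * (2 * dlog_theta4 ^ 2 - 2 * odd_sig 3) - 2 * qderiv (odd_sig 3) + 3 * dlog_theta4 * (2 * dlog_theta4 ^ 2 - 2 * odd_sig 3) + dlog_theta4 ^ 3)"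
    unfolding * by simp
  also have "\<dots> = 2 * (qderiv (odd_sig 3) - 8 * dlog_theta4 * odd_sig 3)"
    by algebra
  finally show ?thesis by (rule fps_double_cancel)
qed

lemma dlog_theta4_dil: "dlog_theta4 = 2 * dil dlog_theta4 - 2 * lambert_G"
  by (simp add: dlog_theta4_def lambert_G_def algebra_simps)

text \<open>Logarithmic differentiation of \<open>theta3_theta4\<close>: the logarithmic derivatives
  of \<open>theta3\<close> and \<open>theta4\<close> add up to \<open>4 * dil dlog_theta4\<close>,
  which \<open>dlog_theta4_dil\<close> rewrites.\<close>

lemma qderiv_theta3: "qderiv theta3 = (dlog_theta4 + 4 * lambert_G) * theta3"
proof -
  have "theta4 * qderiv theta3 + dlog_theta4 * (theta3 * theta4) = 4 * dil dlog_theta4 * (theta3 * theta4)"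
  proof -
    have "qderiv (theta3 * theta4) = 4 * dil dlog_theta4 * (theta3 * theta4)"
      unfolding theta3_theta4 by (simp add: qderiv_dil power2_eq_square qderiv_theta4' algebra_simps)
    thus ?thesis by (simp add: qderiv_theta4' algebra_simps)
  qed
  also have "4 * dil dlog_theta4 = 2 * (dlog_theta4 + 2 * lambert_G)" by (subst dlog_theta4_dil) simp
  finally have "theta4 * qderiv theta3 = theta4 * ((dlog_theta4 + 4 * lambert_G) * theta3)"
    by (simp add: algebra_simps)
  thus ?thesis using theta4_neq_0 by simp
qed

section \<open>Relations between the fourth powers of the theta constants\<close>

context
  fixes x z om :: "int fps"
  defines "x \<equiv> theta3 ^ 4" and "z \<equiv> theta4 ^ 4" and "om \<equiv> theta3 ^ 4 - theta4 ^ 4"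
begin

lemma om: "om = x - z" by (simp add: om_def x_def z_def)

lemma qderiv_x: "qderiv x = 4 * (dlog_theta4 + 4 * lambert_G) * x"
  and qderiv_z: "qderiv z = 4 * dlog_theta4 * z"
  by (simp_all add: x_def z_def power4_eq_xxxx qderiv_theta3 qderiv_theta4' algebra_simps)

lemma qderiv_om: "qderiv om = 4 * dlog_theta4 * om + 16 * lambert_G * x"
  by (simp add: om qderiv_x qderiv_z algebra_simps)

lemma xz: "x * z = dil z ^ 2"
  unfolding x_def z_def using theta3_theta4 by simp algebra

text \<open>The doubling formulas say that \<open>theta3 ^ 2\<close> and \<open>theta4 ^ 2\<close>
  have arithmetic mean \<open>dil (theta3 ^ 2)\<close> and geometric mean
  \<open>dil (theta4 ^ 2)\<close>. Here and in \<open>x_plus_z\<close> a symmetric function of the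
  two squares is expressed through these means.\<close>

lemma om_sq: "om ^ 2 = 16 * dil om * dil x"
  unfolding x_def om_def using theta3_theta4 theta3_sq_theta4_sq by simp algebra

lemma x_plus_z: "x + z = 2 * (2 * dil x - dil z)"
  unfolding x_def z_def using theta3_theta4 theta3_sq_theta4_sq by simp algebra

lemma om_nth: "om $ 0 = 0" "om $ Suc 0 = 16"
  by (simp_all add: om_def power4_eq_xxxx fps_mult_nth theta4_nth_0 theta4_nth_1 theta3_nth_0 theta3_nth_1)

lemma om_neq_0: "om \<noteq> 0" using om_nth by auto

lemma x_plus_z_neq_0: "x + z \<noteq> 0"
proof -
  have "(x + z) $ 0 = 2" by (simp add: x_def z_def theta4_nth_0 theta3_nth_0 power4_eq_xxxx)
  thus ?thesis by (metis fps_zero_nth zero_neq_numeral)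
qed

text \<open>
  Differentiating \<open>om_sq\<close> shows that \<open>f = 16 G\<close> solves \<open>f \<cdot> om(q\<^sup>2) = om \<cdot> f(q\<^sup>2)\<close>. So does \<open>f = om\<close>, and comparing
  orders of vanishing, a nonzero difference of the two would have order \<open>1\<close>.
\<close>

lemma lambert_G_om: "16 * lambert_G = om"
proof (rule ccontr)
  assume ne: "16 * lambert_G \<noteq> om"
  define u2 where "u2 = dil dlog_theta4"
  have u2: "dlog_theta4 = 2 * u2 - 2 * lambert_G" unfolding u2_def by (rule dlog_theta4_dil)
  have "2 * (om * (4 * dlog_theta4 * om + 16 * lambert_G * x)) = qderiv (om ^ 2)"
    by (simp add: power2_eq_square qderiv_om algebra_simps)
  also have "\<dots> = 2 * (16 * ((4 * u2 * dil om + 16 * dil lambert_G * dil x) * dil x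
      + dil om * (4 * (u2 + 4 * dil lambert_G) * dil x)))"
    unfolding om_sq by (simp add: qderiv_dil qderiv_om qderiv_x u2_def algebra_simps)
  finally have D: "om * (4 * dlog_theta4 * om + 16 * lambert_G * x) =
      16 * ((4 * u2 * dil om + 16 * dil lambert_G * dil x) * dil x + dil om * (4 * (u2 + 4 * dil lambert_G) * dil x))"
    by (rule fps_double_cancel)
  \<comment> \<open>Substituting \<open>dlog_theta4 = 2 * u2 - 2 * lambert_G\<close> makes the terms
    in \<open>u2\<close> cancel by \<open>om_sq\<close>; what remains has the common factor
    \<open>x + z\<close>.\<close>
  have "16 * lambert_G * x * om = om * (4 * dlog_theta4 * om + 16 * lambert_G * x) - 4 * dlog_theta4 * om ^ 2"
    by algebra
  also have "\<dots> = 16 * ((4 * u2 * dil om + 16 * dil lambert_G * dil x) * dil x + dil om * (4 * (u2 + 4 * dil lambert_G) * dil x))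
      - 4 * dlog_theta4 * om ^ 2"
    unfolding D ..
  also have "\<dots> = 256 * dil lambert_G * dil x * (dil x + dil om) + 8 * lambert_G * (16 * dil om * dil x)"
    unfolding om_sq unfolding u2 by algebra
  also have "\<dots> = 128 * dil lambert_G * dil x * (x + z) + 8 * lambert_G * om ^ 2"
    unfolding x_plus_z om_sq by (simp add: om algebra_simps)
  finally have "16 * ((x + z) * (lambert_G * om)) = 16 * ((x + z) * (16 * dil lambert_G * dil x))"
    unfolding om by algebra
  hence "(x + z) * (lambert_G * om) = (x + z) * (16 * dil lambert_G * dil x)" by (rule fps_sixteen_cancel)
  hence *: "lambert_G * om = 16 * dil lambert_G * dil x" using x_plus_z_neq_0 by simp
  have "om * (lambert_G * dil om) = om * (om * dil lambert_G)"
    using * om_sq by algebra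
  hence **: "lambert_G * dil om = om * dil lambert_G" using om_neq_0 by simp
  define h where "h = 16 * lambert_G - om"
  have h0: "h \<noteq> 0" using ne by (simp add: h_def)
  have "h * dil om = 16 * (lambert_G * dil om) - om * dil om" by (simp add: h_def algebra_simps)
  also have "\<dots> = om * dil h" unfolding ** by (simp add: h_def algebra_simps)
  finally have h: "h * dil om = om * dil h" .
  have sub: "subdegree (dil f) = 2 * subdegree f" for f :: "int fps"
    unfolding dil_def by (subst subdegree_fps_compose) (simp_all add: fps_X_power_subdegree)
  have "dil h \<noteq> 0" "dil om \<noteq> 0" using h0 om_neq_0 by (auto simp: dil_def fps_compose_eq_0_iff)
  hence "subdegree (h * dil om) = subdegree h + 2 * subdegree om"
      "subdegree (om * dil h) = subdegree om + 2 * subdegree h"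
    using h0 om_neq_0 by (simp_all only: subdegree_mult sub not_False_eq_True)
  hence "subdegree h + 2 * subdegree om = subdegree om + 2 * subdegree h"
    unfolding h by simp
  moreover have "subdegree om = 1" using om_nth by (intro subdegreeI) auto
  ultimately have "subdegree h = 1" by linarith
  hence "h $ 1 \<noteq> 0" using nth_subdegree_nonzero [OF h0] by simp
  thus False by (simp add: h_def lambert_G_nth om_nth numeral_fps_const fps_mult_left_const_nth)
qed

lemma z_eq: "z = x - 16 * lambert_G"
  by (simp add: lambert_G_om om)

text \<open>Both sides satisfy \<open>f - dil f = 24 * lambert_G\<close>. For the right side,
  \<open>x_plus_z\<close> gives \<open>2 * dil (2 * x - z) = x + z\<close>, and
  \<open>x - z = 16 * lambert_G\<close>.\<close>

lemma Jser_eq: "Jser = 2 * x - z"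
proof (rule dil_diff_eqI)
  show "Jser - dil Jser = 24 * lambert_G"
    by (simp add: Jser_def lambert_G_def odd_sig_def algebra_simps)
  have "2 * ((2 * x - z) - dil (2 * x - z)) = 2 * (2 * x - z) - 2 * (2 * dil x - dil z)"
    by (simp add: algebra_simps)
  also have "\<dots> = 2 * (24 * lambert_G)"
    unfolding x_plus_z [symmetric] unfolding z_eq by (simp add: algebra_simps)
  finally show "(2 * x - z) - dil (2 * x - z) = 24 * lambert_G" by (rule fps_double_cancel)
  show "Jser $ 0 = (2 * x - z) $ 0"
    by (simp add: Jser_def x_def z_def theta4_nth_0 theta3_nth_0 sig_def divisor_sum_0 dil_nth
        numeral_fps_const fps_mult_left_const_nth power4_eq_xxxx)
qed

lemma qderiv_lambert_G: "qderiv lambert_G = 4 * dlog_theta4 * lambert_G + lambert_G * x"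
proof (rule fps_sixteen_cancel)
  have "16 * qderiv lambert_G = qderiv om" using arg_cong [OF lambert_G_om, of qderiv] by simp
  also have "\<dots> = 16 * (4 * dlog_theta4 * lambert_G + lambert_G * x)"
    unfolding qderiv_om unfolding lambert_G_om [symmetric] by algebra
  finally show "16 * qderiv lambert_G = 16 * (4 * dlog_theta4 * lambert_G + lambert_G * x)" .
qed

lemma Gx_dil: "dil (lambert_G * x) = lambert_G ^ 2"
proof -
  have "16 * (16 * dil (lambert_G * x)) = 16 * dil (16 * lambert_G) * dil x" by simp
  also have "\<dots> = (16 * lambert_G) ^ 2" unfolding lambert_G_om by (rule om_sq [symmetric])
  also have "\<dots> = 16 * (16 * lambert_G ^ 2)" by algebra
  finally show ?thesis by (rule fps_sixteen_cancel [OF fps_sixteen_cancel])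
qed

text \<open>Differentiating \<open>dlog_theta4_dil\<close> and inserting
  \<open>qderiv_dlog_theta4\<close>, also in dilated form, gives \<open>odd_sig 3 - 4 * dil (odd_sig
  3) = lambert_G * x - 4 * lambert_G ^ 2\<close>. By \<open>Gx_dil\<close> the right side is the
  same expression in \<open>lambert_G * x\<close>.\<close>

lemma odd_sig_3: "odd_sig 3 = lambert_G * x"
proof (rule dil_eqI [where c = 4])
  define u2 d where "u2 = dil dlog_theta4" and "d = dil (odd_sig 3)"
  have u2: "dlog_theta4 = 2 * u2 - 2 * lambert_G" unfolding u2_def by (rule dlog_theta4_dil)
  have "qderiv (dil dlog_theta4) = 2 * (2 * u2 ^ 2 - 2 * d)"
    by (simp add: qderiv_dil qderiv_dlog_theta4 u2_def d_def)
  hence D: "qderiv dlog_theta4 = 2 * (2 * (2 * u2 ^ 2 - 2 * d)) - 2 * (4 * dlog_theta4 * lambert_G + lambert_G * x)"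
    unfolding qderiv_lambert_G [symmetric] by (subst dlog_theta4_dil) simp
  have "2 * odd_sig 3 = 2 * dlog_theta4 ^ 2 - qderiv dlog_theta4"
    by (simp add: qderiv_dlog_theta4)
  also have "\<dots> = 2 * dlog_theta4 ^ 2 - (2 * (2 * (2 * u2 ^ 2 - 2 * d)) - 2 * (4 * dlog_theta4 * lambert_G + lambert_G * x))"
    unfolding D ..
  also have "\<dots> = 2 * (4 * d + lambert_G * x - 4 * lambert_G ^ 2)"
    unfolding u2 by algebra
  finally have "odd_sig 3 = 4 * d + lambert_G * x - 4 * lambert_G ^ 2"
    by (rule fps_double_cancel)
  thus "odd_sig 3 - lambert_G * x = 4 * dil (odd_sig 3 - lambert_G * x)"
    unfolding dil_diff Gx_dil d_def [symmetric] by (simp add: algebra_simps)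
  show "odd_sig 3 $ 0 = (lambert_G * x) $ 0"
    by (simp add: odd_sig_def sig_def divisor_sum_0 dil_nth lambert_G_nth)
qed

lemma odd_sig_5_eq: "odd_sig 5 = lambert_G * x * (2 * x - z)"
  unfolding odd_sig_5 unfolding odd_sig_3 qderiv_mult qderiv_lambert_G qderiv_x z_eq
  by (simp add: algebra_simps)

text \<open>Under \<open>dil\<close> the factor \<open>2 * x - z\<close> becomes half of
  \<open>x + z\<close>, and the quadratic factor becomes \<open>x * z - 2 * om ^ 2\<close> by
  \<open>xz\<close> and \<open>om_sq\<close>. Hence both sides have
  \<open>f - dil f = - 504 * odd_sig 5\<close>.\<close>

lemma E6ser_eq: "E6ser = (2 * x - z) * (z ^ 2 - 32 * x * (x - z))"
proof (rule dil_diff_eqI)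
  define e where "e = (2 * x - z) * (z ^ 2 - 32 * x * (x - z))"
  show "E6ser - dil E6ser = - 504 * (lambert_G * x * (2 * x - z))"
    unfolding odd_sig_5_eq [symmetric] by (simp add: E6ser_def odd_sig_def algebra_simps)
  have "e - dil e = - 504 * (lambert_G * x * (2 * x - z))"
  proof (rule fps_sixteen_cancel, rule fps_double_cancel)
    have "2 * dil e = (x + z) * (dil z ^ 2 - 32 * dil x * dil om)"
      unfolding e_def x_plus_z by (simp add: om)
    also have "\<dots> = (x + z) * (x * z - 2 * om ^ 2)"
      unfolding om_sq xz by simp
    finally have d: "2 * dil e = (x + z) * (x * z - 2 * om ^ 2)" .
    have "2 * (16 * (e - dil e)) = 32 * e - 16 * (2 * dil e)" by simp
    also have "\<dots> = 32 * e - 16 * ((x + z) * (x * z - 2 * om ^ 2))" unfolding d ..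
    also have "\<dots> = 2 * (16 * (- 504 * (lambert_G * x * (2 * x - z))))"
      unfolding lambert_G_om [symmetric] e_def unfolding z_eq by algebra
    finally show "2 * (16 * (e - dil e)) = 2 * (16 * (- 504 * (lambert_G * x * (2 * x - z))))" .
  qed
  thus "(2 * x - z) * (z ^ 2 - 32 * x * (x - z)) - dil ((2 * x - z) * (z ^ 2 - 32 * x * (x - z))) =
      - 504 * (lambert_G * x * (2 * x - z))"
    unfolding e_def .
  show "E6ser $ 0 = ((2 * x - z) * (z ^ 2 - 32 * x * (x - z))) $ 0"
    by (simp add: E6ser_def x_def z_def theta4_nth_0 theta3_nth_0 sig_def divisor_sum_0
        numeral_fps_const fps_mult_left_const_nth power4_eq_xxxx power2_eq_square)
qed

text \<open>With \<open>w = lambert_G / z\<close> and \<open>A = z ^ 2\<close> one has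
  \<open>1 + 16 * w = x / z\<close> and \<open>A * (w + 16 * w ^ 2) = lambert_G * x\<close>, so the
  claims reduce to the relations among \<open>x\<close>, \<open>z\<close> and
  \<open>lambert_G\<close>. The differential equation later identifies \<open>w + 16 * w ^ 2\<close>
  with the expansion of \<open>t\<close>.\<close>

theorem hauptmodul:
  obtains w A :: "int fps" where "w $ 0 = 0" "w $ 1 = 1"
    "dil (w + 16 * w ^ 2) * (1 + 16 * w) = w ^ 2"
    "dil A = A * (1 + 16 * w)"
    "qderiv (w + 16 * w ^ 2) = (w + 16 * w ^ 2) * Jser"
    "8 * Jser ^ 3 + E6ser = 9 * Jser * A"
proof -
  \<comment> \<open>The constant term of \<open>theta4\<close> is \<open>1\<close>, so its
    reciprocal, and with it \<open>w\<close>, has integer coefficients.\<close>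
  define yi where "yi = fps_right_inverse theta4 1"
  have yi: "theta4 * yi = 1" unfolding yi_def by (rule fps_right_inverse) (simp add: theta4_nth_0)
  have "yi $ 0 = 1" using arg_cong [OF yi, of "\<lambda>f. f $ 0"] by (simp add: theta4_nth_0)
  define w where "w = lambert_G * yi ^ 4"
  have zw: "z * w = lambert_G"
    using yi unfolding z_def w_def by algebra
  have zne: "z \<noteq> 0" using theta4_neq_0 by (simp add: z_def)
  have "x = z + 16 * lambert_G" using lambert_G_om om by simp
  hence x: "x = z * (1 + 16 * w)" by (simp add: zw [symmetric] algebra_simps)
  define A where "A = z ^ 2"
  define tq where "tq = w + 16 * w ^ 2"
  have Atq: "A * tq = lambert_G * x" unfolding A_def tq_def x zw [symmetric] by algebra
  have dA: "dil A = A * (1 + 16 * w)" using xz x unfolding A_def by simp algebra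
  have "z ^ 2 * (dil tq * (1 + 16 * w)) = dil A * dil tq"
    unfolding dA by (simp add: A_def algebra_simps)
  also have "\<dots> = lambert_G ^ 2" using arg_cong [OF Atq, of dil] unfolding Gx_dil by simp
  also have "\<dots> = z ^ 2 * w ^ 2" unfolding zw [symmetric] by (simp add: power_mult_distrib)
  finally have 1: "dil tq * (1 + 16 * w) = w ^ 2" using zne by simp
  have "qderiv A = 8 * dlog_theta4 * A" by (simp add: A_def power2_eq_square qderiv_z algebra_simps)
  hence "A * qderiv tq = A * (tq * Jser)"
  proof -
    have "qderiv (A * tq) = (8 * dlog_theta4 + 2 * x - z) * (A * tq)"
      unfolding Atq qderiv_mult qderiv_lambert_G qderiv_x z_eq by algebra
    thus ?thesis using \<open>qderiv A = _\<close> by (simp add: Jser_eq algebra_simps)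
  qed
  hence 2: "qderiv tq = tq * Jser" using zne by (simp add: A_def)
  have 3: "8 * Jser ^ 3 + E6ser = 9 * Jser * A"
    unfolding Jser_eq E6ser_eq A_def by algebra
  have "w $ 0 = 0" "w $ 1 = 1"
    by (simp_all add: w_def fps_mult_nth_0 fps_mult_nth_1 lambert_G_nth \<open>yi $ 0 = 1\<close> fps_power_zeroth)
  thus ?thesis using that [of w A] 1 2 3 dA by (simp add: tq_def)
qed

end

section \<open>The operator U\<close>

definition U2 :: "int fps \<Rightarrow> int fps" where
  "U2 f = Abs_fps (\<lambda>n. f $ (2 * n))"

lemma U2_nth [simp]: "U2 f $ n = f $ (2 * n)"
  by (simp add: U2_def)

lemma U2_0 [simp]: "U2 0 = 0"
  and U2_add [simp]: "U2 (f + g) = U2 f + U2 g"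
  and U2_diff [simp]: "U2 (f - g) = U2 f - U2 g"
  and U2_dil [simp]: "U2 (dil f) = f"
  by (simp_all add: fps_eq_iff dil_nth)

text \<open>Series in \<open>q^2\<close> act as scalars for \<open>U2\<close>, because only the even
  indices of \<open>dil g\<close> contribute to the convolution.\<close>

lemma U2_mult_dil: "U2 (dil g * f) = g * U2 f"
proof (rule fps_ext)
  fix n
  have "U2 (dil g * f) $ n = (\<Sum>i\<in>{0..2 * n}. dil g $ i * f $ (2 * n - i))"
    by (simp add: fps_mult_nth)
  also have "\<dots> = (\<Sum>i\<in>(\<lambda>j. 2 * j) ` {0..n}. dil g $ i * f $ (2 * n - i))"
    by (rule sum.mono_neutral_right) (auto simp: dil_nth elim!: evenE)
  also have "\<dots> = (\<Sum>j\<in>{0..n}. g $ j * f $ (2 * n - 2 * j))"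
    by (subst sum.reindex) (auto simp: inj_on_def dil_nth)
  also have "\<dots> = (g * U2 f) $ n"
    by (simp add: fps_mult_nth diff_mult_distrib2)
  finally show "U2 (dil g * f) $ n = (g * U2 f) $ n" .
qed

lemma U2_numeral_mult [simp]: "U2 (numeral k * f) = numeral k * U2 f"
  using U2_mult_dil [of "numeral k" f] by simp

lemma U2_qderiv: "U2 (qderiv f) = 2 * qderiv (U2 f)"
  by (rule fps_ext) (simp add: qderiv_nth numeral_fps_const fps_mult_left_const_nth)

section \<open>Integral polynomials in a series and their q-adic closure\<close>

inductive_set int_polys :: "int fps \<Rightarrow> int fps set" for x where
  const: "fps_const c \<in> int_polys x"
| gen: "x \<in> int_polys x"
| add: "f \<in> int_polys x \<Longrightarrow> g \<in> int_polys x \<Longrightarrow> f + g \<in> int_polys x"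
| mult: "f \<in> int_polys x \<Longrightarrow> g \<in> int_polys x \<Longrightarrow> f * g \<in> int_polys x"

lemma int_polys_numeral: "numeral k \<in> int_polys x" and int_polys_1: "1 \<in> int_polys x" and int_polys_0: "0 \<in> int_polys x"
  using int_polys.const [of "numeral k"] int_polys.const [of 1] int_polys.const [of 0] by (simp_all add: numeral_fps_const)

lemma int_polys_uminus: "f \<in> int_polys x \<Longrightarrow> - f \<in> int_polys x"
  using int_polys.mult [OF int_polys.const [of "- 1"]] by (fastforce simp flip: fps_const_neg)

lemma int_polys_power: "f \<in> int_polys x \<Longrightarrow> f ^ n \<in> int_polys x"
  by (induction n) (auto intro: int_polys.mult int_polys_1)

lemma int_polys_sum: "(\<And>i. i \<in> I \<Longrightarrow> f i \<in> int_polys x) \<Longrightarrow> sum f I \<in> int_polys x"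
  by (induction I rule: infinite_finite_induct) (auto intro: int_polys.add int_polys_0)

lemmas int_polys_intros = int_polys.intros int_polys_numeral int_polys_1 int_polys_0

lemma int_polys_mono: "f \<in> int_polys x \<Longrightarrow> x \<in> int_polys y \<Longrightarrow> f \<in> int_polys y"
  by (induction rule: int_polys.induct) (auto intro: int_polys_intros)

lemma int_polys_decompose: "f \<in> int_polys x \<Longrightarrow> \<exists>c. \<exists>k\<in>int_polys x. f = fps_const c + x * k"
proof (induction rule: int_polys.induct)
  case (const c)
  show ?case by (rule exI [of _ c], rule bexI [of _ 0]) (auto intro: int_polys_intros)
next
  case gen
  show ?case by (rule exI [of _ 0], rule bexI [of _ 1]) (auto intro: int_polys_intros)
next
  case (add f g)
  then obtain c k c' k' where *: "f = fps_const c + x * k" "g = fps_const c' + x * k'"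
    "k \<in> int_polys x" "k' \<in> int_polys x" by blast
  have "f + g = fps_const (c + c') + x * (k + k')"
    by (simp add: * algebra_simps flip: fps_const_add)
  thus ?case using * by (blast intro: int_polys.add)
next
  case (mult f g)
  then obtain c k c' k' where *: "f = fps_const c + x * k" "g = fps_const c' + x * k'"
    "k \<in> int_polys x" "k' \<in> int_polys x" by blast
  have "f * g = fps_const (c * c') + x * (k * g + fps_const c * k')"
    by (simp add: * algebra_simps flip: fps_const_mult)
  thus ?case using * mult.hyps by (blast intro: int_polys_intros)
qed

text \<open>The closure in the q-adic topology. It admits the reciprocals of \<open>1 - 64 t\<close>
  and \<open>1 + 64 t\<close>, while the action of \<open>U2\<close> is computed on polynomials
  only.\<close>

definition int_polys_closure :: "int fps \<Rightarrow> int fps set" where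
  "int_polys_closure x = {f. \<forall>N. \<exists>p\<in>int_polys x. \<forall>i<N. f $ i = p $ i}"

lemma int_polys_closure_base: "f \<in> int_polys x \<Longrightarrow> f \<in> int_polys_closure x"
  by (auto simp: int_polys_closure_def)

lemma fps_mult_nth_cong:
  assumes "\<forall>i<N. f $ i = f' $ i" "\<forall>i<N. g $ i = g' $ i" "i < (N::nat)"
  shows "(f * g) $ i = (f' * g') $ i"
  using assms by (auto simp: fps_mult_nth intro!: sum.cong)

lemma int_polys_closure_mult:
  assumes "f \<in> int_polys_closure x" "g \<in> int_polys_closure x"
  shows "f * g \<in> int_polys_closure x"
  unfolding int_polys_closure_def
proof (intro CollectI allI)
  fix N
  obtain p q where *: "p \<in> int_polys x" "\<forall>i<N. f $ i = p $ i" "q \<in> int_polys x" "\<forall>i<N. g $ i = q $ i"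
    using assms unfolding int_polys_closure_def by blast
  thus "\<exists>p\<in>int_polys x. \<forall>i<N. (f * g) $ i = p $ i"
    using fps_mult_nth_cong [OF *(2,4)] by (blast intro: int_polys.mult)
qed

lemma int_polys_closure_power: "f \<in> int_polys_closure x \<Longrightarrow> f ^ n \<in> int_polys_closure x"
  by (induction n) (auto intro: int_polys_closure_mult int_polys_closure_base int_polys_1)

text \<open>A truncated geometric series: \<open>v\<close> differs from the sum of
  \<open>c ^ k\<close> over \<open>k < N\<close> by \<open>c ^ N * v\<close>, whose order is at
  least \<open>N\<close>.\<close>

lemma int_polys_closure_inverse:
  assumes v: "(1 - c) * v = 1" and c: "c \<in> int_polys x" "c $ 0 = 0"
  shows "v \<in> int_polys_closure x"
  unfolding int_polys_closure_def
proof (intro CollectI allI)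
  fix N
  have "(1 - c ^ N) * v = (\<Sum>k<N. c ^ k) * ((1 - c) * v)"
    by (simp add: one_diff_power_eq mult_ac)
  hence "v = (\<Sum>k<N. c ^ k) + c ^ N * v"
    unfolding v by (simp add: algebra_simps)
  moreover have "(c ^ N * v) $ i = 0" if "i < N" for i
    using fps_mult_nth_cong [of N "c ^ N" 0 v v i] startsby_zero_power_prefix [OF c(2)] that by simp
  ultimately have "\<forall>i<N. v $ i = (\<Sum>k<N. c ^ k) $ i"
    by (metis add.right_neutral fps_add_nth)
  thus "\<exists>p\<in>int_polys x. \<forall>i<N. v $ i = p $ i"
    using c by (blast intro: int_polys_sum int_polys_power)
qed

lemma dil_U2_odd_square:
  assumes "U2 g = 0"
  shows "dil (U2 (g * g)) = g * g"
proof (rule fps_ext)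
  fix n
  have g: "g $ (2 * k) = 0" for k using assms by (metis U2_nth fps_zero_nth)
  have "(g * g) $ n = 0" if "odd n"
    unfolding fps_mult_nth
  proof (rule sum.neutral, rule ballI)
    fix i assume "i \<in> {0..n}"
    hence "even i \<or> even (n - i)" using that by auto
    thus "g $ i * g $ (n - i) = 0" using g by (metis evenE mult_zero_left mult_zero_right)
  qed
  thus "dil (U2 (g * g)) $ n = (g * g) $ n" by (auto simp: dil_nth)
qed

section \<open>The action of U on the form A Dt times polynomials in 64t\<close>

locale hauptmodul_pair =
  fixes w A tq :: "int fps"
  assumes w_nth: "w $ 0 = 0" "w $ 1 = 1"
    and tq: "tq = w + 16 * w ^ 2"
    and quad: "dil tq * (1 + 16 * w) = w ^ 2"
    and dil_A: "dil A = A * (1 + 16 * w)"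
begin

text \<open>With \<open>T = dil tq\<close>, \<open>w\<close> is a root of
  \<open>Y^2 = T + 16 T Y\<close>; the other root is \<open>w(-q)\<close>, and the sum
  \<open>16 T\<close> of the roots is twice the even part \<open>dil (U2 w)\<close>. In the proof
  \<open>g\<close> is the odd part of \<open>w\<close>, and separating even and odd exponents in
  \<open>quad\<close> gives \<open>dil k * g = 0\<close>.\<close>

lemma U2_w: "U2 w = 8 * tq"
proof -
  define g where "g = w - dil (U2 w)"
  define k where "k = 16 * tq - 2 * U2 w"
  define r where "r = U2 w ^ 2 + U2 (g * g) - tq - 16 * tq * U2 w"
  have g: "U2 g = 0" by (simp add: g_def)
  have w: "w = dil (U2 w) + g" by (simp add: g_def)
  have "dil k * g = dil r"
  proof -
    have "dil r = dil (U2 w) ^ 2 + g * g - dil tq - 16 * dil tq * dil (U2 w)"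
      by (simp add: r_def dil_U2_odd_square [OF g])
    also have "\<dots> = (dil (U2 w) + g) ^ 2 - dil tq * (1 + 16 * (dil (U2 w) + g)) + dil k * g"
      by (simp add: k_def power2_eq_square algebra_simps)
    also have "\<dots> = dil k * g"
      unfolding w [symmetric] quad by simp
    finally show ?thesis ..
  qed
  moreover from this have "r = k * U2 g" by (metis U2_dil U2_mult_dil)
  ultimately have "dil k * g = 0" using g by simp
  moreover have "g $ 1 = 1" by (simp add: g_def w_nth dil_nth flip: One_nat_def)
  hence "g \<noteq> 0" by auto
  ultimately have "dil k = 0" by simp
  hence "k = 0" by (metis U2_0 U2_dil)
  hence "2 * U2 w = 2 * (8 * tq)" by (simp add: k_def)
  thus ?thesis by (subst (asm) mult_cancel_left) simp
qed

lemma U2_w_power2: "U2 (w ^ 2) = tq + 128 * tq ^ 2"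
proof -
  have "U2 (w ^ 2) = U2 (dil tq + dil tq * (16 * w))"
    unfolding quad [symmetric] by (simp add: algebra_simps)
  thus ?thesis by (simp add: U2_mult_dil U2_w power2_eq_square)
qed

lemma U2_qderiv_w: "U2 (qderiv w) = 16 * qderiv tq"
  by (simp add: U2_qderiv U2_w)

lemma U2_w_qderiv_w: "U2 (16 * w * qderiv w) = 16 * (1 + 256 * tq) * qderiv tq"
proof -
  have "U2 (16 * w * qderiv w) = 8 * U2 (qderiv (w ^ 2))"
  proof -
    have "16 * w * qderiv w = 8 * qderiv (w ^ 2)" by (simp add: power2_eq_square)
    thus ?thesis by (simp only: U2_numeral_mult)
  qed
  also have "\<dots> = 16 * (1 + 256 * tq) * qderiv tq"
    unfolding U2_qderiv U2_w_power2 by (simp add: power2_eq_square algebra_simps)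
  finally show ?thesis .
qed

lemma W_power2: "(16 * w) * (16 * w) = dil (256 * tq) * (1 + 16 * w)"
proof -
  have "(16 * w) * (16 * w) = 256 * w ^ 2" by (simp add: power2_eq_square)
  also have "\<dots> = dil (256 * tq) * (1 + 16 * w)" unfolding quad [symmetric] by simp
  finally show ?thesis .
qed

text \<open>The span of \<open>1\<close> and \<open>W = 16 * w\<close> over the polynomials in
  \<open>256 * dil tq\<close>. By \<open>W_power2\<close> it is a ring, and it contains
  \<open>64 * tq = 4 * W * (1 + W)\<close>.\<close>

definition lifts :: "int fps set" where
  "lifts = {f. \<exists>\<alpha>\<in>int_polys (256 * tq). \<exists>\<beta>\<in>int_polys (256 * tq). f = dil \<alpha> + 16 * w * dil \<beta>}"

lemma liftsI: "\<alpha> \<in> int_polys (256 * tq) \<Longrightarrow> \<beta> \<in> int_polys (256 * tq) \<Longrightarrow> dil \<alpha> + 16 * w * dil \<beta> \<in> lifts"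
  unfolding lifts_def by blast

lemma lifts_dil: "\<alpha> \<in> int_polys (256 * tq) \<Longrightarrow> dil \<alpha> \<in> lifts"
  using liftsI [of \<alpha> 0] by (simp add: int_polys_0)

lemma lifts_w: "16 * w \<in> lifts"
  using liftsI [of 0 1] by (simp add: int_polys_0 int_polys_1)

lemma lifts_add: "f \<in> lifts \<Longrightarrow> g \<in> lifts \<Longrightarrow> f + g \<in> lifts"
proof -
  assume "f \<in> lifts" "g \<in> lifts"
  then obtain a b c d where *: "a \<in> int_polys (256 * tq)" "b \<in> int_polys (256 * tq)" "c \<in> int_polys (256 * tq)"
      "d \<in> int_polys (256 * tq)" "f = dil a + 16 * w * dil b" "g = dil c + 16 * w * dil d"
    unfolding lifts_def by blast
  hence "f + g = dil (a + c) + 16 * w * dil (b + d)" by (simp add: algebra_simps)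
  moreover have "dil (a + c) + 16 * w * dil (b + d) \<in> lifts"
    using * by (blast intro: liftsI int_polys.add)
  ultimately show "f + g \<in> lifts" by (rule ssubst)
qed

lemma lifts_mult: "f \<in> lifts \<Longrightarrow> g \<in> lifts \<Longrightarrow> f * g \<in> lifts"
proof -
  assume "f \<in> lifts" "g \<in> lifts"
  then obtain a b c d where *: "a \<in> int_polys (256 * tq)" "b \<in> int_polys (256 * tq)" "c \<in> int_polys (256 * tq)"
      "d \<in> int_polys (256 * tq)" "f = dil a + 16 * w * dil b" "g = dil c + 16 * w * dil d"
    unfolding lifts_def by blast
  have "f * g = dil a * dil c + 16 * w * (dil a * dil d + dil b * dil c) + (16 * w) * (16 * w) * (dil b * dil d)"
    unfolding * by algebra
  also have "\<dots> = dil (a * c + 256 * tq * (b * d)) + 16 * w * dil (a * d + b * c + 256 * tq * (b * d))"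
    unfolding W_power2 by (simp add: algebra_simps)
  finally have "f * g = dil (a * c + 256 * tq * (b * d)) + 16 * w * dil (a * d + b * c + 256 * tq * (b * d))" .
  moreover have "dil (a * c + 256 * tq * (b * d)) + 16 * w * dil (a * d + b * c + 256 * tq * (b * d)) \<in> lifts"
    using * by (blast intro: liftsI int_polys.add int_polys.mult int_polys.gen)
  ultimately show "f * g \<in> lifts" by (rule ssubst)
qed

lemma tq_eq: "64 * tq = 4 * (16 * w * (1 + 16 * w))"
  by (simp add: tq power2_eq_square algebra_simps)

lemma int_polys_lifts: "f \<in> int_polys (64 * tq) \<Longrightarrow> f \<in> lifts"
proof (induction rule: int_polys.induct)
  case (const c)
  show ?case using lifts_dil [OF int_polys.const [of c]] by simp
next
  case gen
  have "numeral k \<in> lifts" "1 \<in> lifts" for k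
    using lifts_dil [OF int_polys_numeral] lifts_dil [OF int_polys_1] by simp_all
  thus ?case unfolding tq_eq by (intro lifts_mult lifts_add lifts_w)
qed (auto intro: lifts_add lifts_mult)

text \<open>The common factor of \<open>C6a\<close> and \<open>C6b\<close>: when \<open>tq\<close>
  is the expansion of \<open>t\<close>, that of \<open>t * (8 * J ^ 3 + E6)\<close> is
  \<open>9 * form\<close>.\<close>

definition form :: "int fps" where "form = A * qderiv tq"

text \<open>With \<open>W = 16 * w\<close> one has \<open>qderiv tq = (1 + 2 * W) * qderiv w\<close>
  and \<open>A = dil A / (1 + W)\<close>. By \<open>W_power2\<close> the quotient of
  \<open>1 + 2 * W\<close> by \<open>1 + W\<close> is \<open>1 - dil (256 * tq) + W\<close>, so
  \<open>U2_mult_dil\<close> becomes applicable.\<close>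

lemma form_eq: "form = dil A * ((1 - dil (256 * tq) + 16 * w) * qderiv w)"
proof -
  have "qderiv tq = (1 + 2 * (16 * w)) * qderiv w"
    by (simp add: tq power2_eq_square algebra_simps)
  moreover have "(1 + 16 * w) * (1 - dil (256 * tq) + 16 * w) = 1 + 2 * (16 * w)"
  proof -
    have "(1 + 16 * w) * (1 - dil (256 * tq) + 16 * w) =
        1 + 2 * (16 * w) + (16 * w) * (16 * w) - dil (256 * tq) * (1 + 16 * w)"
      by algebra
    thus ?thesis unfolding W_power2 by simp
  qed
  ultimately show ?thesis unfolding form_def dil_A by (metis mult.assoc)
qed

text \<open>The two contributions with the factor \<open>256 * tq\<close> cancel, and the other two
  give \<open>16\<close> each.\<close>

lemma U2_form: "U2 form = 32 * form"
proof -
  have "U2 form = A * U2 (qderiv w - dil (256 * tq) * qderiv w + 16 * w * qderiv w)"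
    unfolding form_eq U2_mult_dil by (simp add: algebra_simps)
  also have "\<dots> = A * (16 * qderiv tq - 256 * tq * (16 * qderiv tq) + 16 * (1 + 256 * tq) * qderiv tq)"
    unfolding U2_add U2_diff U2_mult_dil U2_qderiv_w U2_w_qderiv_w ..
  also have "\<dots> = 32 * form" unfolding form_def by algebra
  finally show ?thesis .
qed

text \<open>With \<open>W = 16 * w\<close>, the factor \<open>64 * tq = 4 * W * (1 + W)\<close>
  supplies \<open>4\<close>, and its \<open>W\<close> leaves only terms in
  \<open>W * qderiv w\<close> and \<open>W ^ 2 * qderiv w\<close>, on which \<open>U2\<close>
  supplies \<open>16\<close>. The product \<open>64\<close> exceeds the required \<open>32\<close>
  by the factor \<open>2\<close> in \<open>p\<close>.\<close>

lemma U2_form_mult_tq: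
  assumes "k \<in> int_polys (64 * tq)"
  shows "\<exists>p\<in>int_polys (64 * tq). U2 (form * (64 * tq * k)) = 32 * (form * p)"
proof -
  \<comment> \<open>This is what remains of \<open>64 * tq * k\<close> and the factor from
    \<open>form_eq\<close> once \<open>4 * (16 * w)\<close> is split off.\<close>
  have "(1 + 16 * w) * (1 + dil (- (256 * tq)) + 16 * w) * k \<in> lifts"
    using lifts_dil [OF int_polys_1] lifts_dil [OF int_polys_uminus [OF int_polys.gen]] int_polys_lifts [OF assms]
    by (intro lifts_mult lifts_add lifts_w) simp_all
  then obtain a b where ab: "a \<in> int_polys (256 * tq)" "b \<in> int_polys (256 * tq)"
      "(1 + 16 * w) * (1 + dil (- (256 * tq)) + 16 * w) * k = dil a + 16 * w * dil b"
    unfolding lifts_def by blast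
  have sub: "f \<in> int_polys (256 * tq) \<Longrightarrow> f \<in> int_polys (64 * tq)" for f
    by (erule int_polys_mono) (use int_polys.mult [OF int_polys_numeral [of "num.Bit0 (num.Bit0 num.One)"] int_polys.gen [of "64 * tq"]] in simp)
  have "form * (64 * tq * k) =
      dil A * (4 * (16 * w * ((1 + 16 * w) * (1 + dil (- (256 * tq)) + 16 * w) * k) * qderiv w))"
    unfolding form_eq tq_eq dil_minus by algebra
  also have "\<dots> = dil A * (4 * (dil a * (16 * w * qderiv w) + dil b * ((16 * w) * (16 * w) * qderiv w)))"
    unfolding ab(3) by algebra
  also have "\<dots> = dil A * (4 * (dil a * (16 * w * qderiv w)
      + dil b * (dil (256 * tq) * (qderiv w + 16 * w * qderiv w))))"
    unfolding W_power2 by algebra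
  finally have "U2 (form * (64 * tq * k)) = A * (4 * (a * (16 * (1 + 256 * tq) * qderiv tq)
      + b * (256 * tq * (16 * qderiv tq + 16 * (1 + 256 * tq) * qderiv tq))))"
    by (simp only: U2_mult_dil U2_numeral_mult U2_add U2_qderiv_w U2_w_qderiv_w)
  also have "\<dots> = 32 * (form * (2 * (a * (1 + 256 * tq) + b * (256 * tq * (2 + 256 * tq)))))"
    unfolding form_def by algebra
  finally have "U2 (form * (64 * tq * k)) =
      32 * (form * (2 * (a * (1 + 256 * tq) + b * (256 * tq * (2 + 256 * tq)))))" .
  moreover have "2 * (a * (1 + 256 * tq) + b * (256 * tq * (2 + 256 * tq))) \<in> int_polys (256 * tq)"
    by (intro int_polys.gen int_polys.add int_polys.mult int_polys_numeral int_polys_1 ab)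
  ultimately show ?thesis using sub by blast
qed

text \<open>The constant part of \<open>p\<close> is covered by the eigenvalue equation
  \<open>U2_form\<close>, the rest by \<open>U2_form_mult_tq\<close>.\<close>

lemma U2_form_mult:
  assumes "p \<in> int_polys (64 * tq)"
  shows "\<exists>p'\<in>int_polys (64 * tq). U2 (form * p) = 32 * (form * p')"
proof -
  obtain c k where ck: "k \<in> int_polys (64 * tq)" "p = fps_const c + 64 * tq * k"
    using int_polys_decompose [OF assms] by blast
  obtain p' where p': "p' \<in> int_polys (64 * tq)" "U2 (form * (64 * tq * k)) = 32 * (form * p')"
    using U2_form_mult_tq [OF ck(1)] by blast
  have "form * p = dil (fps_const c) * form + form * (64 * tq * k)"
    unfolding ck(2) dil_const by algebra
  hence "U2 (form * p) = fps_const c * (32 * form) + 32 * (form * p')"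
    by (simp only: U2_add U2_mult_dil U2_form p'(2))
  also have "\<dots> = 32 * (form * (fps_const c + p'))" by algebra
  finally show ?thesis using int_polys.add [OF int_polys.const p'(1)] by blast
qed

text \<open>Each \<open>U2\<close> splits off \<open>32\<close> and leaves \<open>form\<close> times
  a polynomial in \<open>64 * tq\<close>. For \<open>f\<close> in the closure this is carried out to
  every finite order.\<close>

theorem form_mult_nth_dvd:
  assumes "f \<in> int_polys_closure (64 * tq)"
  shows "32 ^ r dvd (form * f) $ (2 ^ r * m)"
proof -
  have "\<forall>N. \<exists>p\<in>int_polys (64 * tq). \<forall>i<N. (form * f) $ (2 ^ r * i) = 32 ^ r * (form * p) $ i"
  proof (induction r)
    case 0
    show ?case
    proof
      fix N
      obtain p where "p \<in> int_polys (64 * tq)" "\<forall>i<N. f $ i = p $ i"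
        using assms unfolding int_polys_closure_def by blast
      thus "\<exists>p\<in>int_polys (64 * tq). \<forall>i<N. (form * f) $ (2 ^ 0 * i) = 32 ^ 0 * (form * p) $ i"
        using fps_mult_nth_cong [of N form form f p] by auto
    qed
  next
    case (Suc r)
    show ?case
    proof
      fix N
      \<comment> \<open>Coefficients below \<open>N\<close> after one more \<open>U2\<close> come
        from coefficients below \<open>2 * N\<close>.\<close>
      obtain p where p: "p \<in> int_polys (64 * tq)"
          "\<forall>i<2 * N. (form * f) $ (2 ^ r * i) = 32 ^ r * (form * p) $ i"
        using Suc.IH by blast
      obtain p' where p': "p' \<in> int_polys (64 * tq)" "U2 (form * p) = 32 * (form * p')"
        using U2_form_mult [OF p(1)] by blast
      have "(form * f) $ (2 ^ Suc r * i) = 32 ^ Suc r * (form * p') $ i" if "i < N" for i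
      proof -
        have "(form * f) $ (2 ^ r * (2 * i)) = 32 ^ r * (form * p) $ (2 * i)"
          using p(2) that by simp
        also have "(form * p) $ (2 * i) = 32 * (form * p') $ i"
          using arg_cong [OF p'(2), of "\<lambda>g. g $ i"]
          by (simp add: numeral_fps_const fps_mult_left_const_nth)
        finally show ?thesis by (simp add: mult_ac)
      qed
      thus "\<exists>p\<in>int_polys (64 * tq). \<forall>i<N. (form * f) $ (2 ^ Suc r * i) = 32 ^ Suc r * (form * p) $ i"
        using p'(1) by blast
    qed
  qed
  then obtain p where "(form * f) $ (2 ^ r * m) = 32 ^ r * (form * p) $ m"
    by (meson lessI)
  thus ?thesis by simp
qed

end

section \<open>Analytic functions of the nome\<close>

definition cfps :: "int fps \<Rightarrow> complex fps" where
  "cfps f = Abs_fps (\<lambda>n. of_int (f $ n))"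

lemma cfps_nth [simp]: "cfps f $ n = of_int (f $ n)"
  by (simp add: cfps_def)

lemma cfps_1 [simp]: "cfps 1 = 1"
  and cfps_numeral [simp]: "cfps (numeral k) = numeral k"
  and cfps_add [simp]: "cfps (f + g) = cfps f + cfps g"
  and cfps_diff [simp]: "cfps (f - g) = cfps f - cfps g"
  and cfps_mult [simp]: "cfps (f * g) = cfps f * cfps g"
  and cfps_dil [simp]: "cfps (dil f) = dil (cfps f)"
  and cfps_qderiv [simp]: "cfps (qderiv f) = qderiv (cfps f)"
  by (simp_all add: fps_eq_iff fps_mult_nth dil_nth qderiv_nth numeral_fps_const)

lemma cfps_power [simp]: "cfps (f ^ n) = cfps f ^ n"
  by (induction n) simp_all

lemma divisor_sum_le: "divisor_sum k n \<le> n ^ Suc k"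
proof (cases "n = 0")
  case False
  have "divisor_sum k n \<le> (\<Sum>d\<in>{1..n}. n ^ k)"
    unfolding divisor_sum_def
  proof (rule sum_le_included [where i = id])
    show "\<forall>d\<in>{d. d dvd n}. \<exists>y\<in>{1..n}. id y = d \<and> d ^ k \<le> n ^ k"
      using False by (auto simp: dvd_imp_le power_mono Suc_le_eq intro!: Nat.gr0I)
  qed (use False in auto)
  thus ?thesis by simp
qed (simp add: divisor_sum_def)

lemma fps_conv_radius_powers: "fps_conv_radius (Abs_fps (\<lambda>n. of_nat n ^ k) :: complex fps) \<ge> 1"
proof (induction k)
  case 0
  have "summable (\<lambda>n. of_real r ^ n :: complex)" if "0 < r" "ereal r < 1" for r
    using that by (simp add: summable_geometric one_ereal_def)
  thus ?case unfolding fps_conv_radius_def by (intro conv_radius_geI_ex') simp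
next
  case (Suc k)
  define f :: "complex fps" where "f = Abs_fps (\<lambda>n. of_nat n ^ k)"
  have "1 \<le> min (fps_conv_radius (fps_X :: complex fps)) (fps_conv_radius (fps_deriv f))"
    using Suc.IH fps_conv_radius_deriv [of f] by (simp add: f_def)
  also have "\<dots> \<le> fps_conv_radius (fps_X * fps_deriv f)"
    by (rule fps_conv_radius_mult)
  also have "fps_X * fps_deriv f = Abs_fps (\<lambda>n. of_nat n ^ Suc k)"
    unfolding qderiv_def [symmetric] by (simp add: fps_eq_iff qderiv_nth f_def)
  finally show ?case .
qed

lemma fps_conv_radius_sig: "fps_conv_radius (cfps (sig k)) \<ge> 1"
  unfolding fps_conv_radius_def
proof (rule conv_radius_geI_ex')
  fix r :: real assume r: "0 < r" "ereal r < 1"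
  have "ereal r < fps_conv_radius (Abs_fps (\<lambda>n. of_nat n ^ Suc k) :: complex fps)"
    by (rule less_le_trans [OF r(2) fps_conv_radius_powers])
  hence "ereal (norm (complex_of_real r)) < conv_radius (\<lambda>n. of_nat n ^ Suc k :: complex)"
    using r by (simp add: fps_conv_radius_def)
  hence *: "summable (\<lambda>n. norm (of_nat n ^ Suc k * complex_of_real r ^ n))"
    by (rule abs_summable_in_conv_radius)
  show "summable (\<lambda>n. cfps (sig k) $ n * complex_of_real r ^ n)"
  proof (rule summable_comparison_test' [OF *])
    fix n :: nat
    have "real (divisor_sum k n) \<le> real n ^ Suc k"
      using divisor_sum_le [of k n] by (metis of_nat_le_iff of_nat_power)
    thus "norm (cfps (sig k) $ n * complex_of_real r ^ n) \<le> norm (of_nat n ^ Suc k * complex_of_real r ^ n)"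
      using r by (simp add: sig_def norm_power norm_mult mult_right_mono)
  qed
qed

lemma sig_has_fps_expansion:
  "(\<lambda>q. \<Sum>n. of_nat (divisor_sum k (Suc n)) * q ^ Suc n) has_fps_expansion cfps (sig k)"
proof (rule has_fps_expansionI)
  have "eventually (\<lambda>q. q \<in> ball 0 1) (nhds (0::complex))"
    by (intro eventually_nhds_in_open) auto
  thus "eventually (\<lambda>q. (\<lambda>n. cfps (sig k) $ n * q ^ n) sums (\<Sum>n. of_nat (divisor_sum k (Suc n)) * q ^ Suc n)) (nhds 0)"
  proof eventually_elim
    case (elim q)
    hence "ereal (norm q) < 1" by (simp add: one_ereal_def)
    hence "summable (\<lambda>n. cfps (sig k) $ n * q ^ n)"
      using fps_conv_radius_sig [of k] by (intro summable_fps) (rule less_le_trans)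
    hence "summable (\<lambda>n. cfps (sig k) $ Suc n * q ^ Suc n)"
      by (subst summable_Suc_iff)
    hence "(\<lambda>n. cfps (sig k) $ Suc n * q ^ Suc n) sums (\<Sum>n. cfps (sig k) $ Suc n * q ^ Suc n)"
      by (rule summable_sums)
    thus ?case
      by (subst (asm) sums_Suc_iff) (simp add: sig_def divisor_sum_0)
  qed
qed

section \<open>The Euler product and the expansion of t\<close>

definition euler :: "complex \<Rightarrow> complex" where
  "euler q = (\<Prod>n. 1 - q ^ Suc n)"

definition euler_part :: "nat \<Rightarrow> complex fps" where
  "euler_part n = (\<Prod>k<n. 1 - fps_X ^ Suc k)"

text \<open>For \<open>norm q \<le> 1/2\<close> the factors differ from \<open>1\<close> by at most
  \<open>(1/2) ^ Suc n\<close>. This gives uniform convergence and keeps the factors nonzero, so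
  that the infinite product is the limit of its partial products.\<close>

lemma uniform_limit_euler:
  "uniform_limit (cball 0 (1/2)) (\<lambda>n q. \<Prod>k<n. 1 - q ^ Suc k) euler sequentially"
proof -
  have bound: "norm (1 - q ^ Suc n - 1) \<le> (1/2) ^ Suc n" if "q \<in> cball 0 (1/2)" for q :: complex and n
    using that power_mono [of "norm q" "1/2" "Suc n"] by (simp add: norm_power norm_mult)
  have geom: "summable (\<lambda>n. (1/2) ^ Suc n :: real)"
    by (subst summable_Suc_iff) (simp add: summable_geometric)
  have "uniformly_convergent_on (cball 0 (1/2)) (\<lambda>n q. \<Prod>k<n. 1 - q ^ Suc k :: complex)"
  proof (rule uniformly_convergent_on_prod')
    show "uniformly_convergent_on (cball 0 (1/2)) (\<lambda>N q. \<Sum>n<N. norm (1 - q ^ Suc n - 1 :: complex))"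
      by (rule Weierstrass_m_test' [where M = "\<lambda>n. (1/2) ^ Suc n"])
        (use bound geom in \<open>simp_all del: power_Suc\<close>)
  qed (auto intro!: continuous_intros)
  hence "uniform_limit (cball 0 (1/2)) (\<lambda>n q. \<Prod>k<n. 1 - q ^ Suc k)
      (\<lambda>q :: complex. lim (\<lambda>n. \<Prod>k<n. 1 - q ^ Suc k)) sequentially"
    by (simp only: uniformly_convergent_uniform_limit_iff)
  moreover have lim: "lim (\<lambda>n. \<Prod>k<n. 1 - q ^ Suc k) = euler q" if q: "q \<in> cball 0 (1/2)" for q
    unfolding euler_def
  proof (rule prodinf_eq_lim' [symmetric])
    show "convergent_prod (\<lambda>k. 1 - q ^ Suc k)"
    proof (intro abs_convergent_prod_imp_convergent_prod summable_imp_abs_convergent_prod)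
      show "summable (\<lambda>k. norm (1 - q ^ Suc k - 1))"
        by (rule summable_comparison_test' [OF geom]) (use bound [OF q] in simp)
    qed
    show "1 - q ^ Suc k \<noteq> 0" for k
    proof
      assume "1 - q ^ Suc k = 0"
      hence "norm (1 - q ^ Suc k - 1) = 1" by simp
      moreover have "(1/2) ^ Suc k < (1::real)" by (rule power_Suc_less_one) auto
      ultimately show False using bound [OF q, of k] by linarith
    qed
  qed
  have "uniform_limit (cball 0 (1/2)) (\<lambda>n q. \<Prod>k<n. 1 - q ^ Suc k)
      (\<lambda>q :: complex. lim (\<lambda>n. \<Prod>k<n. 1 - q ^ Suc k)) sequentially \<longleftrightarrow> ?thesis"
    by (rule uniform_limit_cong' [OF refl lim])
  ultimately show ?thesis by simp
qed

lemma euler_part_has_fps_expansion: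
  "(\<lambda>q. \<Prod>k<n. 1 - q ^ Suc k) has_fps_expansion euler_part n"
  unfolding euler_part_def by (intro fps_expansion_intros)

lemma euler_part_stable: "m \<le> n \<Longrightarrow> euler_part n $ m = euler_part m $ m"
proof (induction n rule: dec_induct)
  case (step n)
  have "euler_part (Suc n) = euler_part n - fps_X ^ Suc n * euler_part n"
    by (simp add: euler_part_def algebra_simps del: power_Suc)
  thus ?case using step by (simp add: fps_X_power_mult_nth del: power_Suc)
qed simp

text \<open>Derivatives at \<open>0\<close> commute with the uniform limit, and the
  \<open>m\<close>-th Taylor coefficient of the partial products is constant from the
  \<open>m\<close>-th product on.\<close>

lemma euler_has_fps_expansion:
  "euler has_fps_expansion Abs_fps (\<lambda>m. euler_part m $ m)"
proof -
  have lim: "uniform_limit (ball 0 (1/2)) (\<lambda>n q. \<Prod>k<n. 1 - q ^ Suc k) euler sequentially"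
    by (rule uniform_limit_on_subset [OF uniform_limit_euler]) auto
  have "euler holomorphic_on ball 0 (1/2)"
  proof (rule holomorphic_uniform_sequence)
    fix q :: complex assume "q \<in> ball 0 (1/2)"
    then obtain d where "d > 0" "cball q d \<subseteq> ball 0 (1/2)"
      by (meson open_ball open_contains_cball)
    thus "\<exists>d>0. cball q d \<subseteq> ball 0 (1/2) \<and> uniform_limit (cball q d) (\<lambda>n q. \<Prod>k<n. 1 - q ^ Suc k) euler sequentially"
      using uniform_limit_on_subset [OF lim] by blast
  qed (auto intro!: holomorphic_intros)
  hence *: "euler has_fps_expansion fps_expansion euler 0"
    by (intro has_fps_expansion_fps_expansion [of "ball 0 (1/2)"]) auto
  have "fps_expansion euler 0 $ m = euler_part m $ m" for m
  proof -
    have "(\<lambda>n. (deriv ^^ m) (\<lambda>q. \<Prod>k<n. 1 - q ^ Suc k) 0) \<longlonglongrightarrow> (deriv ^^ m) euler 0"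
      by (rule higher_deriv_complex_uniform_limit [OF lim]) (auto intro!: holomorphic_intros always_eventually)
    moreover have "(deriv ^^ m) (\<lambda>q. \<Prod>k<n. 1 - q ^ Suc k) 0 = fact m * euler_part m $ m" if "n \<ge> m" for n
      using fps_nth_fps_expansion [OF euler_part_has_fps_expansion, of n m] euler_part_stable [OF that]
      by (simp add: field_simps)
    hence "(\<lambda>n. (deriv ^^ m) (\<lambda>q. \<Prod>k<n. 1 - q ^ Suc k) 0) \<longlonglongrightarrow> fact m * euler_part m $ m"
      by (intro tendsto_eventually) (use eventually_ge_at_top [of m] in eventually_elim, simp)
    ultimately have "(deriv ^^ m) euler 0 = fact m * euler_part m $ m"
      by (rule LIMSEQ_unique)
    thus ?thesis by (simp add: fps_nth_fps_expansion [OF *])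
  qed
  hence "fps_expansion euler 0 = Abs_fps (\<lambda>m. euler_part m $ m)" by (simp add: fps_eq_iff)
  with * show ?thesis by simp
qed

definition eulerfps :: "complex fps" where
  "eulerfps = Abs_fps (\<lambda>m. euler_part m $ m)"

text \<open>The expansion of \<open>k q^k / (1 - q^k)\<close>, the negative logarithmic derivative
  of \<open>1 - q^k\<close>. The condition \<open>0 < m\<close> excludes the constant term, since
  every \<open>k\<close> divides \<open>0\<close>.\<close>

definition lambert_term :: "nat \<Rightarrow> complex fps" where
  "lambert_term k = Abs_fps (\<lambda>m. if 0 < m \<and> k dvd m then of_nat k else 0)"

lemma lambert_term: "k > 0 \<Longrightarrow> (1 - fps_X ^ k) * lambert_term k = of_nat k * fps_X ^ k"
  by (rule fps_ext)
    (auto simp: lambert_term_def fps_of_nat [symmetric] left_diff_distrib fps_X_power_mult_nth dvd_minus_self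
      dest: dvd_imp_le)

lemma qderiv_euler_part:
  "qderiv (euler_part n) = - (euler_part n * (\<Sum>k<n. lambert_term (Suc k)))"
proof (induction n)
  case (Suc n)
  have "qderiv (fps_X ^ Suc n :: complex fps) = of_nat (Suc n) * fps_X ^ Suc n"
    by (rule fps_ext) (simp add: qderiv_nth fps_of_nat [symmetric] del: power_Suc of_nat_Suc)
  also have "\<dots> = (1 - fps_X ^ Suc n) * lambert_term (Suc n)"
    by (rule lambert_term [symmetric]) simp
  finally have X: "qderiv (fps_X ^ Suc n) = (1 - fps_X ^ Suc n) * lambert_term (Suc n)" .
  have "euler_part (Suc n) = euler_part n * (1 - fps_X ^ Suc n)"
    by (simp add: euler_part_def del: power_Suc)
  thus ?case
    unfolding sum.lessThan_Suc
    by (simp only: qderiv_mult qderiv_diff qderiv_1 X Suc.IH) (simp add: algebra_simps del: power_Suc)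
qed (simp add: euler_part_def)

text \<open>Only the first \<open>m\<close> factors reach degree \<open>m\<close>, and up to that
  degree their Lambert terms add up to \<open>sig 1\<close>.\<close>

lemma qderiv_eulerfps: "qderiv eulerfps = - (eulerfps * cfps (sig 1))"
proof (rule fps_ext)
  fix m
  have "(eulerfps * cfps (sig 1)) $ m = (euler_part m * (\<Sum>k<m. lambert_term (Suc k))) $ m"
    unfolding fps_mult_nth
  proof (rule sum.cong)
    fix i assume "i \<in> {0..m}"
    hence i: "i \<le> m" by simp
    have "cfps (sig 1) $ n = (\<Sum>k<m. lambert_term (Suc k)) $ n" if "n \<le> m" for n
    proof (cases "n = 0")
      case False
      have "(\<Sum>k<m. lambert_term (Suc k)) $ n = (\<Sum>k<m. if Suc k dvd n then of_nat (Suc k) else 0)"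
        using False by (simp add: fps_sum_nth lambert_term_def)
      also have "\<dots> = (\<Sum>d\<in>Suc ` {..<m}. if d dvd n then of_nat d else 0)"
        by (simp add: sum.reindex)
      also have "\<dots> = (\<Sum>d | d dvd n. of_nat d)"
      proof (rule sum.mono_neutral_cong_right)
        show "{d. d dvd n} \<subseteq> Suc ` {..<m}"
        proof
          fix d assume "d \<in> {d. d dvd n}"
          hence "d dvd n" by simp
          hence "0 < d" "d \<le> m" using False that dvd_imp_le [of d n] by (auto intro: Nat.gr0I)
          thus "d \<in> Suc ` {..<m}" by (intro image_eqI [of _ _ "d - 1"]) auto
        qed
      qed auto
      finally show ?thesis by (simp add: sig_def divisor_sum_def)
    qed (simp add: sig_def divisor_sum_0 fps_sum_nth lambert_term_def)
    thus "eulerfps $ i * cfps (sig 1) $ (m - i) = euler_part m $ i * (\<Sum>k<m. lambert_term (Suc k)) $ (m - i)"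
      using euler_part_stable [OF i] by (simp add: eulerfps_def)
  qed simp
  also have "\<dots> = - (qderiv (euler_part m) $ m)"
    by (simp add: qderiv_euler_part)
  also have "\<dots> = - (qderiv eulerfps $ m)"
    by (simp add: qderiv_nth eulerfps_def)
  finally show "qderiv eulerfps $ m = (- (eulerfps * cfps (sig 1))) $ m" by simp
qed

lemma eulerfps_0: "eulerfps $ 0 = 1"
  by (simp add: eulerfps_def euler_part_def)


lemma has_fps_expansion_dil: "f has_fps_expansion F \<Longrightarrow> (\<lambda>q. f (q ^ 2)) has_fps_expansion dil F"
  for f :: "complex \<Rightarrow> complex"
  using has_fps_expansion_compose [of f F "\<lambda>q. q ^ 2" "fps_X ^ 2"] has_fps_expansion_fps_X_power [of 2]
  by (simp add: dil_def o_def)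

lemma qderiv_power_eq: "qderiv f = f * k \<Longrightarrow> qderiv (f ^ n) = f ^ n * (of_nat n * k)"
  by (induction n) (simp_all add: algebra_simps)

text \<open>After clearing \<open>eulerfps ^ 24\<close>, both sides solve
  \<open>qderiv y = y * (1 - 48 * dil (cfps (sig 1)))\<close> with coefficient \<open>1\<close> at
  \<open>q\<close>. The multiplier has constant term \<open>1\<close>, so this coefficient
  determines the solution.\<close>

lemma t_has_fps_expansion:
  fixes f :: "int fps"
  assumes "qderiv f = f * Jser" "f $ 0 = 0" "f $ 1 = 1"
  shows "(\<lambda>q. q * (euler (q ^ 2) / euler q) ^ 24) has_fps_expansion cfps f"
proof -
  have eu: "euler has_fps_expansion eulerfps"
    unfolding eulerfps_def by (rule euler_has_fps_expansion)
  have "(\<lambda>q. q * (euler (q ^ 2) / euler q) ^ 24) has_fps_expansion fps_X * (dil eulerfps / eulerfps) ^ 24"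
    by (intro fps_expansion_intros has_fps_expansion_dil eu) (simp add: eulerfps_0)
  moreover have "fps_X * dil eulerfps ^ 24 = cfps f * eulerfps ^ 24"
  proof (rule qderiv_ode_unique [where m = 1])
    have *: "qderiv eulerfps = eulerfps * - cfps (sig 1)" by (simp add: qderiv_eulerfps)
    have "qderiv (dil eulerfps) = dil eulerfps * (- 2 * dil (cfps (sig 1)))"
      by (simp add: qderiv_dil *)
    from qderiv_power_eq [OF this, of 24] qderiv_power_eq [OF *, of 24]
    have 1: "qderiv (dil eulerfps ^ 24) = dil eulerfps ^ 24 * (- 48 * dil (cfps (sig 1)))"
      and 2: "qderiv (eulerfps ^ 24) = eulerfps ^ 24 * (- 24 * cfps (sig 1))"
      by simp_all
    show "qderiv (fps_X * dil eulerfps ^ 24) = fps_X * dil eulerfps ^ 24 * (1 - 48 * dil (cfps (sig 1)))"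
      unfolding qderiv_mult 1 by (simp add: qderiv_def algebra_simps)
    have q: "qderiv (cfps f) = cfps f * (1 + 24 * cfps (sig 1) - 48 * dil (cfps (sig 1)))"
      unfolding cfps_qderiv [symmetric] assms(1) by (simp add: Jser_def)
    show "qderiv (cfps f * eulerfps ^ 24) = cfps f * eulerfps ^ 24 * (1 - 48 * dil (cfps (sig 1)))"
      unfolding qderiv_mult 2 q by (simp add: algebra_simps)
    show "(1 - 48 * dil (cfps (sig 1))) $ 0 = of_nat 1"
      by (simp add: dil_nth sig_def divisor_sum_0)
    show "(fps_X * dil eulerfps ^ 24) $ 1 = (cfps f * eulerfps ^ 24) $ 1"
      using assms(2,3) by (simp add: fps_mult_nth_1 fps_power_zeroth eulerfps_0 dil_nth)
  qed
  hence "fps_X * (dil eulerfps / eulerfps) ^ 24 = cfps f"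
    using eulerfps_0
    by (simp add: fps_divide_unit power_mult_distrib mult.assoc [symmetric] inverse_mult_eq_1'
        flip: fps_inverse_power)
  ultimately show ?thesis by simp
qed

section \<open>From functions of the nome to q-expansions\<close>

lemma nome_double: "nome (2 * \<tau>) = nome \<tau> ^ 2"
  by (simp add: nome_def exp_of_nat_mult [symmetric] algebra_simps)

lemma t_nome: "t \<tau> = nome \<tau> * (euler (nome \<tau> ^ 2) / euler (nome \<tau>)) ^ 24"
proof -
  have "t \<tau> = (exp (2 * of_real pi * \<i> * (2 * \<tau>) / 24) / exp (2 * of_real pi * \<i> * \<tau> / 24)) ^ 24 *
      (euler (nome \<tau> ^ 2) / euler (nome \<tau>)) ^ 24"
    unfolding t_def eta_def euler_def nome_double [symmetric] by (simp add: power_mult_distrib [symmetric])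
  also have "exp (2 * of_real pi * \<i> * (2 * \<tau>) / 24) / exp (2 * of_real pi * \<i> * \<tau> / 24) = exp (2 * of_real pi * \<i> * \<tau> / 24)"
    by (simp add: exp_diff [symmetric])
  also have "\<dots> ^ 24 = nome \<tau>"
    by (simp add: exp_of_nat_mult [symmetric] nome_def mult_ac)
  finally show ?thesis .
qed

definition E2q :: "complex \<Rightarrow> complex" where
  "E2q q = 1 - 24 * (\<Sum>n. of_nat (divisor_sum 1 (Suc n)) * q ^ Suc n)"

definition E6q :: "complex \<Rightarrow> complex" where
  "E6q q = 1 - 504 * (\<Sum>n. of_nat (divisor_sum 5 (Suc n)) * q ^ Suc n)"

lemma E6q_has_fps_expansion: "E6q has_fps_expansion cfps E6ser"
proof -
  have "E6q has_fps_expansion 1 - 504 * cfps (sig 5)"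
    unfolding E6q_def by (intro fps_expansion_intros sig_has_fps_expansion)
  thus ?thesis by (simp add: E6ser_def)
qed

lemma J_has_fps_expansion: "(\<lambda>q. 2 * E2q (q ^ 2) - E2q q) has_fps_expansion cfps Jser"
proof -
  have E2: "E2q has_fps_expansion 1 - 24 * cfps (sig 1)"
    unfolding E2q_def by (intro fps_expansion_intros sig_has_fps_expansion)
  have "(\<lambda>q. 2 * E2q (q ^ 2) - E2q q) has_fps_expansion 2 * dil (1 - 24 * cfps (sig 1)) - (1 - 24 * cfps (sig 1))"
    by (intro fps_expansion_intros has_fps_expansion_dil E2)
  thus ?thesis by (simp add: Jser_def algebra_simps)
qed

lemma has_q_expansionI:
  fixes h :: "complex \<Rightarrow> complex" and g :: "int fps"
  assumes "h has_fps_expansion cfps g" "g $ 0 = 0" "\<And>\<tau>. F \<tau> = h (nome \<tau>)"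
  shows "has_q_expansion F (\<lambda>n. of_int (g $ n))"
proof -
  have "eventually (\<lambda>q :: complex. ereal (norm q) < fps_conv_radius (cfps g)) (nhds 0)"
  proof -
    have "0 \<in> eball (0::complex) (fps_conv_radius (cfps g))"
      using assms(1) by (simp add: has_fps_expansion_def zero_ereal_def)
    with open_eball have "eventually (\<lambda>q. q \<in> eball (0::complex) (fps_conv_radius (cfps g))) (nhds 0)"
      by (rule eventually_nhds_in_open)
    thus ?thesis by (rule eventually_mono) (simp add: in_eball_iff)
  qed
  moreover have "eventually (\<lambda>q. eval_fps (cfps g) q = h q) (nhds 0)"
    using assms(1) by (simp add: has_fps_expansion_def)
  ultimately have "eventually (\<lambda>q. (\<lambda>n. cfps g $ n * q ^ n) sums h q) (nhds 0)"
  proof eventually_elim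
    case (elim q)
    thus ?case using sums_eval_fps [of q "cfps g"] by simp
  qed
  then obtain \<epsilon> where \<epsilon>: "\<epsilon> > 0" "\<And>q. norm q < \<epsilon> \<Longrightarrow> (\<lambda>n. cfps g $ n * q ^ n) sums h q"
    unfolding eventually_nhds_metric by auto
  show ?thesis
    unfolding has_q_expansion_def
  proof (intro exI allI impI)
    \<comment> \<open>The bound solves \<open>exp (- (2 * pi * Im \<tau>)) < \<epsilon>\<close>, the
      left side being \<open>norm (nome \<tau>)\<close>.\<close>
    fix \<tau> :: complex assume "Im \<tau> > - ln \<epsilon> / (2 * pi)"
    hence "- (2 * pi * Im \<tau>) < ln \<epsilon>" by (simp add: field_simps)
    hence "exp (- (2 * pi * Im \<tau>)) < \<epsilon>" using \<epsilon>(1) by (metis exp_less_cancel_iff exp_ln)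
    hence "norm (nome \<tau>) < \<epsilon>" by (simp add: nome_def)
    from \<epsilon>(2) [OF this] have "(\<lambda>n. cfps g $ Suc n * nome \<tau> ^ Suc n) sums h (nome \<tau>)"
      by (subst sums_Suc_iff) (simp add: assms(2))
    thus "(\<lambda>n. of_rat (of_int (g $ Suc n)) * nome \<tau> ^ Suc n) sums F \<tau>"
      by (simp add: assms(3))
  qed
qed

lemma v2_of_int_ge:
  assumes "32 ^ r dvd (k :: int)"
  shows "v2 (of_int k) \<ge> ereal (5 * real r)"
proof (cases "k = 0")
  case False
  have "(2 :: int) ^ (5 * r) dvd k" using assms by (simp add: power_mult)
  hence "5 * r \<le> multiplicity 2 k"
    by (intro multiplicity_geI) (use False in auto)
  moreover have "quotient_of (of_int k) = (k, 1)" by simp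
  ultimately show ?thesis using False by (simp add: v2_def)
qed (simp add: v2_def)


lemma has_fps_expansion_quotient_mult:
  assumes "n has_fps_expansion cfps N" "d has_fps_expansion cfps D" "m has_fps_expansion cfps M"
    and "D $ 0 \<noteq> 0" "N * M = D * C"
  shows "(\<lambda>q. n q / d q * m q) has_fps_expansion cfps C"
proof -
  have D: "cfps D $ 0 \<noteq> 0" using assms(4) by simp
  have "(\<lambda>q. n q / d q * m q) has_fps_expansion cfps N / cfps D * cfps M"
    by (intro fps_expansion_intros assms D)
  also have "cfps N / cfps D * cfps M = inverse (cfps D) * cfps (N * M)"
    using D by (simp add: fps_divide_unit mult_ac)
  also have "\<dots> = cfps C"
    unfolding assms(5) using D by (simp add: mult.assoc [symmetric] inverse_mult_eq_1)
  finally show ?thesis .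
qed

theorem corollary7p2:
  "\<exists>c6a c6b :: nat \<Rightarrow> rat.
     has_q_expansion C6a c6a \<and> has_q_expansion C6b c6b \<and>
     (\<forall>m r :: nat. m \<ge> 1 \<longrightarrow> r \<ge> 1 \<longrightarrow>
        v2 (c6a (2 ^ r * m)) \<ge> ereal (5 * real r) \<and>
        v2 (c6b (2 ^ r * m)) \<ge> ereal (5 * real r))"
proof -
  obtain w A :: "int fps" where w: "w $ 0 = 0" "w $ 1 = 1"
    "dil (w + 16 * w ^ 2) * (1 + 16 * w) = w ^ 2" "dil A = A * (1 + 16 * w)"
    and ode: "qderiv (w + 16 * w ^ 2) = (w + 16 * w ^ 2) * Jser"
    and E6: "8 * Jser ^ 3 + E6ser = 9 * Jser * A"
    by (rule hauptmodul)
  define s where "s = w + 16 * w ^ 2"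
  interpret hauptmodul_pair w A s
    by unfold_locales (use w in \<open>simp_all add: s_def\<close>)
  have s_nth: "s $ 0 = 0" "s $ 1 = 1"
    using w by (simp_all add: s_def power2_eq_square fps_mult_nth_1)
  have ode: "qderiv s = s * Jser" using ode by (simp add: s_def)
  have form: "9 * form = s * (8 * Jser ^ 3 + E6ser)"
    unfolding form_def ode E6 by algebra

  define a b where "a = fps_right_inverse (1 - 64 * s) 1" and "b = fps_right_inverse (1 + 64 * s) 1"
  \<comment> \<open>The double negation fits \<open>int_polys_closure_inverse\<close> with
    \<open>c = - (64 * s)\<close>.\<close>
  have a: "(1 - 64 * s) * a = 1" and b: "(1 - (- (64 * s))) * b = 1"
    using fps_right_inverse [of "1 - 64 * s" 1] fps_right_inverse [of "1 + 64 * s" 1] s_nth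
    by (simp_all add: a_def b_def)
  \<comment> \<open>Since \<open>1408 = 22 * 64\<close> and \<open>20480 = 5 * 64 ^ 2\<close>, the
    numerator is an integral polynomial in \<open>64 * s\<close>.\<close>
  define f g where "f = (5 + 22 * (64 * s) + 5 * (64 * s) ^ 2) * a ^ 3" and "g = (1 - 64 * s) * b ^ 2"
  have "a \<in> int_polys_closure (64 * s)"
    using s_nth by (intro int_polys_closure_inverse [OF a] int_polys.gen) simp
  hence f: "f \<in> int_polys_closure (64 * s)"
    unfolding f_def
    by (intro int_polys_closure_mult int_polys_closure_power)
      (intro int_polys_closure_base int_polys.add int_polys_numeral int_polys.mult [OF int_polys_numeral] int_polys.gen int_polys_power)
  have "b \<in> int_polys_closure (64 * s)"
    using s_nth by (intro int_polys_closure_inverse [OF b] int_polys_uminus int_polys.gen) simp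
  moreover have "1 + - (64 * s) \<in> int_polys (64 * s)"
    by (intro int_polys.add int_polys_1 int_polys_uminus int_polys.gen)
  ultimately have g: "g \<in> int_polys_closure (64 * s)"
    unfolding g_def by (intro int_polys_closure_mult int_polys_closure_power) (simp_all add: int_polys_closure_base)

  define T where "T = (\<lambda>q. q * (euler (q ^ 2) / euler q) ^ 24)"
  define K where "K = (\<lambda>q. 8 * (2 * E2q (q ^ 2) - E2q q) ^ 3 + E6q q)"
  have T: "T has_fps_expansion cfps s"
    unfolding T_def by (rule t_has_fps_expansion [OF ode s_nth])
  have K: "K has_fps_expansion cfps (8 * Jser ^ 3 + E6ser)"
    unfolding K_def cfps_add cfps_mult cfps_power cfps_numeral
    by (intro fps_expansion_intros J_has_fps_expansion E6q_has_fps_expansion)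
  have K_nome: "8 * J \<tau> ^ 3 + E6 \<tau> = K (nome \<tau>)" for \<tau>
    by (simp add: K_def J_def E2_def E6_def E2q_def E6q_def nome_double)

  have "has_q_expansion C6a (\<lambda>n. of_int ((form * f) $ n))"
  proof (rule has_q_expansionI)
    show "(\<lambda>q. T q * (5 + 1408 * T q + 20480 * T q ^ 2) / (9 * (1 - 64 * T q) ^ 3) * K q) has_fps_expansion cfps (form * f)"
    proof (rule has_fps_expansion_quotient_mult [OF _ _ K])
      show "(\<lambda>q. T q * (5 + 1408 * T q + 20480 * T q ^ 2)) has_fps_expansion cfps (s * (5 + 1408 * s + 20480 * s ^ 2))"
        unfolding cfps_add cfps_mult cfps_power cfps_numeral by (intro fps_expansion_intros T)
      show "(\<lambda>q. 9 * (1 - 64 * T q) ^ 3) has_fps_expansion cfps (9 * (1 - 64 * s) ^ 3)"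
        unfolding cfps_diff cfps_mult cfps_power cfps_numeral cfps_1 by (intro fps_expansion_intros T)
      show "(9 * (1 - 64 * s) ^ 3) $ 0 \<noteq> 0"
        using s_nth by (simp add: fps_power_zeroth)
      have "9 * (1 - 64 * s) ^ 3 * (form * f) = 9 * form * (5 + 22 * (64 * s) + 5 * (64 * s) ^ 2) * ((1 - 64 * s) * a) ^ 3"
        unfolding f_def by algebra
      also have "\<dots> = s * (5 + 1408 * s + 20480 * s ^ 2) * (8 * Jser ^ 3 + E6ser)"
        unfolding form a power_one by algebra
      finally show "s * (5 + 1408 * s + 20480 * s ^ 2) * (8 * Jser ^ 3 + E6ser) = 9 * (1 - 64 * s) ^ 3 * (form * f)" ..
    qed
    show "(form * f) $ 0 = 0" by (simp add: form_def qderiv_nth)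
    show "C6a \<tau> = T (nome \<tau>) * (5 + 1408 * T (nome \<tau>) + 20480 * T (nome \<tau>) ^ 2) / (9 * (1 - 64 * T (nome \<tau>)) ^ 3) * K (nome \<tau>)" for \<tau>
      unfolding C6a_def K_nome T_def t_nome ..
  qed
  moreover have "has_q_expansion C6b (\<lambda>n. of_int ((form * g) $ n))"
  proof (rule has_q_expansionI)
    show "(\<lambda>q. T q * (1 - 64 * T q) / (9 * (1 + 64 * T q) ^ 2) * K q) has_fps_expansion cfps (form * g)"
    proof (rule has_fps_expansion_quotient_mult [OF _ _ K])
      show "(\<lambda>q. T q * (1 - 64 * T q)) has_fps_expansion cfps (s * (1 - 64 * s))"
        unfolding cfps_diff cfps_mult cfps_numeral cfps_1 by (intro fps_expansion_intros T)
      show "(\<lambda>q. 9 * (1 + 64 * T q) ^ 2) has_fps_expansion cfps (9 * (1 + 64 * s) ^ 2)"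
        unfolding cfps_add cfps_mult cfps_power cfps_numeral cfps_1 by (intro fps_expansion_intros T)
      show "(9 * (1 + 64 * s) ^ 2) $ 0 \<noteq> 0"
        using s_nth by (simp add: fps_power_zeroth)
      have "9 * (1 + 64 * s) ^ 2 * (form * g) = 9 * form * (1 - 64 * s) * ((1 - (- (64 * s))) * b) ^ 2"
        unfolding g_def by algebra
      also have "\<dots> = s * (1 - 64 * s) * (8 * Jser ^ 3 + E6ser)"
        unfolding form b power_one by algebra
      finally show "s * (1 - 64 * s) * (8 * Jser ^ 3 + E6ser) = 9 * (1 + 64 * s) ^ 2 * (form * g)" ..
    qed
    show "(form * g) $ 0 = 0" by (simp add: form_def qderiv_nth)
    show "C6b \<tau> = T (nome \<tau>) * (1 - 64 * T (nome \<tau>)) / (9 * (1 + 64 * T (nome \<tau>)) ^ 2) * K (nome \<tau>)" for \<tau>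
      unfolding C6b_def K_nome T_def t_nome ..
  qed
  ultimately show ?thesis
    using v2_of_int_ge [OF form_mult_nth_dvd [OF f]] v2_of_int_ge [OF form_mult_nth_dvd [OF g]] by blast
qed

end
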